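(* Let $n\ge 2$ and let $\lambda: M^{n-1}\to\Lambda^{2n-1}$ be a Legendre submanifold with $g$ distinct curvature spheres $[K_1],\ldots,[K_g]$ at each point. Then $\lambda$ is Lie equivalent to the Legendre lift of an isoparametric hypersurface in $S^n$ if and only if there exist $g$ points $[P_1],\ldots,[P_g]$ on a timelike line in $\mathbf{P}^{n+2}$ such that $$\langle K_i,P_i\rangle=0,\qquad 1\le i\le g.$$
   Context: Let $\mathbf{R}^{n+3}_2$ be $\mathbf{R}^{n+3}$ with the Lie scalar product $\langle x,y\rangle=-x_1y_1+x_2y_2+\cdots+x_{n+2}y_{n+2}-x_{n+3}y_{n+3}$, of signature $(n+1,2)$. Vectors are written $(a,v,b)$ with $a,b\in\mathbf{R}$, $v\in\mathbf{R}^{n+1}$, and $S^n$ is the unit sphere in $\mathbf{R}^{n+1}$. For a nonzero vector $x$, $[x]$ denotes its class in real projective space $\mathbf{P}^{n+2}$. A point $[x]$ is timelike if $\langle x,x\rangle<0$, and a projective line in $\mathbf{P}^{n+2}$ is timelike if it contains only timelike points. The Lie quadric is $Q^{n+1}=\{[x]\in\mathbf{P}^{n+2}:\langle x,x\rangle=0\}$. $\Lambda^{2n-1}$ denotes the set of projective lines of $\mathbf{P}^{n+2}$ contained in $Q^{n+1}$, a smooth manifold of dimension $2n-1$; its smooth structure is the one making the bijection $(p,\xi)\mapsto[(1,p,0),(0,\xi,1)]$ from the unit tangent bundle $T_1S^n=\{(p,\xi)\in S^n\times S^n: p\cdot\xi=0\}$ to $\Lambda^{2n-1}$ a diffeomorphism.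 Here $[a,b]$ is the projective line through $[a]$ and $[b]$. A Legendre submanifold is a smooth map $\lambda:M^{n-1}\to\Lambda^{2n-1}$ from an $(n-1)$-dimensional smooth manifold that can be written $\lambda=[Z_1,Z_{n+3}]$ with smooth maps $Z_1,Z_{n+3}:M^{n-1}\to\mathbf{R}^{n+3}_2$ such that: (1) for each $x$, $Z_1(x),Z_{n+3}(x)$ are linearly independent, and $\langle Z_1,Z_1\rangle=\langle Z_{n+3},Z_{n+3}\rangle=\langle Z_1,Z_{n+3}\rangle=0$; (2) there is no nonzero tangent vector $X$ at any $x\in M^{n-1}$ such that $dZ_1(X)$ and $dZ_{n+3}(X)$ both lie in $\mathrm{Span}\{Z_1(x),Z_{n+3}(x)\}$; (3) $\langle dZ_1,Z_{n+3}\rangle=0$. These conditions do not depend on the choice of smooth frame $Z_1,Z_{n+3}$. For $r,s\in\mathbf{R}$ not both zero, the point $[K]=[rZ_1(x)+sZ_{n+3}(x)]$ of the line $\lambda(x)$ is a curvature sphere of $\lambda$ at $x$ if there is a nonzero $X\in T_xM^{n-1}$ with $r\,dZ_1(X)+s\,dZ_{n+3}(X)\in\mathrm{Span}\{Z_1(x),Z_{n+3}(x)\}$. This does not depend on the choice of $Z_1,Z_{n+3}$. The number $g$ of distinct curvature spheres is assumed here to be the same at every point. The points $[P_i]$ are fixed (independent of $x$), and the condition $\langle K_i,P_i\rangle=0$, $1\le i\le g$, means that at every $x\in M^{n-1}$ the $g$ curvature spheres of $\lambda$ at $x$, suitably labelled $[K_1(x)],\ldots,[K_g(x)]$, satisfy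 $\langle K_i(x),P_i\rangle=0$ for all $i$. A Lie sphere transformation $\beta$ is a projective transformation of $\mathbf{P}^{n+2}$ mapping $Q^{n+1}$ to itself; every such $\beta$ is induced by some linear $B\in O(n+1,2)$, the orthogonal group of $\langle\ ,\ \rangle$, i.e. $\beta[x]=[Bx]$. If $\lambda=[Z_1,Z_{n+3}]$, then $\beta\lambda:M^{n-1}\to\Lambda^{2n-1}$ denotes the Legendre submanifold $[BZ_1,BZ_{n+3}]$; $\lambda$ and $\beta\lambda$ are said to be Lie equivalent. If $f:M^{n-1}\to S^n$ is an immersed oriented hypersurface with field of unit normals $\xi:M^{n-1}\to S^n$ (so $f\cdot\xi=0$ and $df\cdot\xi=0$), its Legendre lift is the Legendre submanifold $[(1,f,0),(0,\xi,1)]$ with domain $M^{n-1}$. The shape operator $A$ of $f$ is defined by $df(AX)=-d\xi(X)$, and its eigenvalues are the principal curvatures of $f$. An immersed oriented hypersurface $f$ is isoparametric if its principal curvatures are constant on $M^{n-1}$. *)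

theory Defs
  imports "HOL-Analysis.Analysis"
begin

section \<open>Smooth manifolds modelled on \<open>real ^ 'm\<close>\<close>

text \<open>\<open>C\<^sup>k\<close> on an open set: all iterated directional derivatives up to order \<open>k\<close> exist
  (as Frechet derivatives applied to fixed vectors) and are continuous.\<close>

primrec Ck_on ::
    "nat \<Rightarrow> 'a::real_normed_vector set \<Rightarrow> ('a \<Rightarrow> 'b::real_normed_vector) \<Rightarrow> bool" where
  "Ck_on 0 S f \<longleftrightarrow> continuous_on S f"
| "Ck_on (Suc k) S f \<longleftrightarrow>
     (\<forall>x\<in>S. f differentiable (at x)) \<and>
     (\<forall>v. Ck_on k S (\<lambda>x. frechet_derivative f (at x) v))"

definition smooth_on ::
    "'a::real_normed_vector set \<Rightarrow> ('a \<Rightarrow> 'b::real_normed_vector) \<Rightarrow> bool" where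
  "smooth_on S f \<longleftrightarrow> (\<forall>k. Ck_on k S f)"

text \<open>A chart is a pair \<open>(U, \<phi>)\<close>; the values of \<open>\<phi>\<close> outside \<open>U\<close> are irrelevant.\<close>

type_synonym ('p, 'm) chart = "'p set \<times> ('p \<Rightarrow> real ^ 'm)"

definition is_chart :: "'p topology \<Rightarrow> ('p, 'm::finite) chart \<Rightarrow> bool" where
  "is_chart M c \<longleftrightarrow> (case c of (U, \<phi>) \<Rightarrow>
     openin M U \<and> open (\<phi> ` U) \<and>
     homeomorphic_map (subtopology M U) (top_of_set (\<phi> ` U)) \<phi>)"

text \<open>The representation \<open>F \<circ> \<phi>\<^sup>-\<^sup>1\<close> of a map in a chart, to be used on \<open>\<phi> ` U\<close>.\<close>

definition in_chart :: "('p, 'm::finite) chart \<Rightarrow> ('p \<Rightarrow> 'b) \<Rightarrow> real ^ 'm \<Rightarrow> 'b" where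
  "in_chart c F = F \<circ> inv_into (fst c) (snd c)"

text \<open>A smooth manifold of dimension \<open>CARD('m)\<close> without boundary: \<open>M\<close> is the underlying
  topological space and \<open>A\<close> is a (not necessarily maximal) smooth atlas.\<close>

definition smooth_manifold :: "'p topology \<Rightarrow> ('p, 'm::finite) chart set \<Rightarrow> bool" where
  "smooth_manifold M A \<longleftrightarrow>
     Hausdorff_space M \<and> second_countable M \<and>
     (\<forall>c\<in>A. is_chart M c) \<and>
     (\<Union>c\<in>A. fst c) = topspace M \<and>
     (\<forall>c\<in>A. \<forall>d\<in>A. smooth_on (snd c ` (fst c \<inter> fst d)) (in_chart c (snd d)))"

definition smooth_map ::
    "('p, 'm::finite) chart set \<Rightarrow> ('p \<Rightarrow> 'b::real_normed_vector) \<Rightarrow> bool" where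
  "smooth_map A F \<longleftrightarrow> (\<forall>c\<in>A. smooth_on (snd c ` fst c) (in_chart c F))"

text \<open>As usual when tangent vectors are handled in coordinates, every point \<open>x\<close> gets a
  preferred chart of the atlas, and the tangent space at \<open>x\<close> is identified with \<open>real ^ 'm\<close> through
  it. Changing the chart changes the identification by a linear isomorphism, which affects
  none of the notions below.\<close>

definition chart_at :: "('p, 'm::finite) chart set \<Rightarrow> 'p \<Rightarrow> ('p, 'm) chart" where
  "chart_at A x = (SOME c. c \<in> A \<and> x \<in> fst c)"

definition differential ::
    "('p, 'm::finite) chart set \<Rightarrow> ('p \<Rightarrow> 'b::real_normed_vector) \<Rightarrow> 'p \<Rightarrow> real ^ 'm \<Rightarrow> 'b" where
  "differential A F x =
     frechet_derivative (in_chart (chart_at A x) F) (at (snd (chart_at A x) x))"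


section \<open>Lie sphere geometry\<close>

text \<open>With \<open>CARD('k) = n + 1\<close>, this type is \<open>R\<^sup>n\<^sup>+\<^sup>3\<close> with vectors written \<open>(a, v, b)\<close>.\<close>

type_synonym 'k lvec = "real \<times> (real ^ 'k) \<times> real"

definition lie_prod :: "'k::finite lvec \<Rightarrow> 'k lvec \<Rightarrow> real" where
  "lie_prod x y = (case x of (a, v, b) \<Rightarrow> case y of (a', v', b') \<Rightarrow>
     - (a * a') + v \<bullet> v' - b * b')"

text \<open>Projective points are one-dimensional linear subspaces; projective lines are sets of
  projective points. The argument of \<open>proj\<close> has to be nonzero, and the arguments of
  \<open>proj_line_through\<close> have to be linearly independent.\<close>

definition proj :: "'k::finite lvec \<Rightarrow> 'k lvec set" where
  "proj x = span {x}"

definition proj_space :: "'k::finite lvec set set" where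
  "proj_space = {proj x | x. x \<noteq> 0}"

definition lin_indep2 :: "'k::finite lvec \<Rightarrow> 'k lvec \<Rightarrow> bool" where
  "lin_indep2 x y \<longleftrightarrow> x \<noteq> y \<and> independent {x, y}"

definition proj_line_through :: "'k::finite lvec \<Rightarrow> 'k lvec \<Rightarrow> 'k lvec set set" where
  "proj_line_through x y = {proj z | z. z \<in> span {x, y} \<and> z \<noteq> 0}"

definition is_proj_line :: "'k::finite lvec set set \<Rightarrow> bool" where
  "is_proj_line L \<longleftrightarrow> (\<exists>x y. lin_indep2 x y \<and> L = proj_line_through x y)"

definition timelike_point :: "'k::finite lvec set \<Rightarrow> bool" where
  "timelike_point p \<longleftrightarrow> (\<exists>x. x \<noteq> 0 \<and> p = proj x \<and> lie_prod x x < 0)"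

definition timelike_line :: "'k::finite lvec set set \<Rightarrow> bool" where
  "timelike_line L \<longleftrightarrow> is_proj_line L \<and> (\<forall>p\<in>L. timelike_point p)"

definition lie_quadric :: "'k::finite lvec set set" where
  "lie_quadric = {proj x | x. x \<noteq> 0 \<and> lie_prod x x = 0}"

definition Lambda :: "'k::finite lvec set set set" where
  "Lambda = {L. is_proj_line L \<and> L \<subseteq> lie_quadric}"

definition unit_tangent_sphere :: "((real ^ 'k::finite) \<times> (real ^ 'k)) set" where
  "unit_tangent_sphere = {(p, \<xi>). norm p = 1 \<and> norm \<xi> = 1 \<and> p \<bullet> \<xi> = 0}"

definition contact_line :: "(real ^ 'k::finite) \<times> (real ^ 'k) \<Rightarrow> 'k lvec set set" where
  "contact_line = (\<lambda>(p, \<xi>). proj_line_through (1, p, 0) (0, \<xi>, 1))"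

text \<open>The smooth structure of \<open>Lambda\<close> is transported from \<open>unit_tangent_sphere\<close> by
  \<open>contact_line\<close>; a map into this submanifold of \<open>(real ^ 'k) \<times> (real ^ 'k)\<close> is smooth iff it is
  smooth as a map into the ambient space.\<close>

definition smooth_map_Lambda ::
    "'p topology \<Rightarrow> ('p, 'm::finite) chart set \<Rightarrow> ('p \<Rightarrow> 'k::finite lvec set set) \<Rightarrow> bool" where
  "smooth_map_Lambda M A lam \<longleftrightarrow>
     (\<forall>x\<in>topspace M. lam x \<in> Lambda) \<and>
     (\<exists>\<sigma>. smooth_map A \<sigma> \<and>
        (\<forall>x\<in>topspace M. \<sigma> x \<in> unit_tangent_sphere \<and> lam x = contact_line (\<sigma> x)))"

definition legendre_frame ::
    "'p topology \<Rightarrow> ('p, 'm::finite) chart set \<Rightarrow> ('p \<Rightarrow> 'k::finite lvec set set) \<Rightarrow>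
     ('p \<Rightarrow> 'k lvec) \<Rightarrow> ('p \<Rightarrow> 'k lvec) \<Rightarrow> bool" where
  "legendre_frame M A lam Z W \<longleftrightarrow>
     smooth_map A Z \<and> smooth_map A W \<and>
     (\<forall>x\<in>topspace M.
        lam x = proj_line_through (Z x) (W x) \<and>
        lin_indep2 (Z x) (W x) \<and>
        lie_prod (Z x) (Z x) = 0 \<and> lie_prod (W x) (W x) = 0 \<and> lie_prod (Z x) (W x) = 0 \<and>
        \<not> (\<exists>X. X \<noteq> 0 \<and> differential A Z x X \<in> span {Z x, W x} \<and>
                differential A W x X \<in> span {Z x, W x}) \<and>
        (\<forall>X. lie_prod (differential A Z x X) (W x) = 0))"

definition legendre_submanifold ::
    "'p topology \<Rightarrow> ('p, 'm::finite) chart set \<Rightarrow> ('p \<Rightarrow> 'k::finite lvec set set) \<Rightarrow> bool" where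
  "legendre_submanifold M A lam \<longleftrightarrow>
     smooth_map_Lambda M A lam \<and> (\<exists>Z W. legendre_frame M A lam Z W)"

text \<open>The points of the line \<open>lam x\<close> that are curvature spheres. They do not depend on the
  frame.\<close>

definition curvature_spheres ::
    "'p topology \<Rightarrow> ('p, 'm::finite) chart set \<Rightarrow> ('p \<Rightarrow> 'k::finite lvec set set) \<Rightarrow>
     'p \<Rightarrow> 'k lvec set set" where
  "curvature_spheres M A lam x =
     {proj (r *\<^sub>R Z x + s *\<^sub>R W x) | r s Z W.
        legendre_frame M A lam Z W \<and> (r \<noteq> 0 \<or> s \<noteq> 0) \<and>
        (\<exists>X. X \<noteq> 0 \<and>
           r *\<^sub>R differential A Z x X + s *\<^sub>R differential A W x X \<in> span {Z x, W x})}"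

text \<open>Transformations of projective space act on sets of vectors; only their values on
  \<open>proj_space\<close> matter.\<close>

definition projective_transformation :: "('k::finite lvec set \<Rightarrow> 'k lvec set) \<Rightarrow> bool" where
  "projective_transformation \<beta> \<longleftrightarrow>
     (\<exists>B. linear B \<and> bij B \<and> (\<forall>x. x \<noteq> 0 \<longrightarrow> \<beta> (proj x) = proj (B x)))"

definition lie_sphere_transformation :: "('k::finite lvec set \<Rightarrow> 'k lvec set) \<Rightarrow> bool" where
  "lie_sphere_transformation \<beta> \<longleftrightarrow>
     projective_transformation \<beta> \<and> \<beta> ` lie_quadric = lie_quadric"

text \<open>If \<open>B\<close> induces \<open>\<beta>\<close>, then \<open>\<beta>\<close> maps the line through \<open>Z\<close> and \<open>W\<close> onto the
  line through \<open>B Z\<close> and \<open>B W\<close>, so the image below is the line \<open>(\<beta> lam) x\<close>.\<close>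

definition lie_equivalent ::
    "'p topology \<Rightarrow> ('p \<Rightarrow> 'k::finite lvec set set) \<Rightarrow> ('p \<Rightarrow> 'k lvec set set) \<Rightarrow> bool" where
  "lie_equivalent M lam mu \<longleftrightarrow>
     (\<exists>\<beta>. lie_sphere_transformation \<beta> \<and> (\<forall>x\<in>topspace M. mu x = \<beta> ` lam x))"


section \<open>Hypersurfaces in the sphere\<close>

definition oriented_hypersurface ::
    "'p topology \<Rightarrow> ('p, 'm::finite) chart set \<Rightarrow>
     ('p \<Rightarrow> real ^ 'k::finite) \<Rightarrow> ('p \<Rightarrow> real ^ 'k) \<Rightarrow> bool" where
  "oriented_hypersurface M A f \<xi> \<longleftrightarrow>
     smooth_map A f \<and> smooth_map A \<xi> \<and>
     (\<forall>x\<in>topspace M.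
        norm (f x) = 1 \<and> inj (differential A f x) \<and>
        norm (\<xi> x) = 1 \<and> f x \<bullet> \<xi> x = 0 \<and> (\<forall>X. differential A f x X \<bullet> \<xi> x = 0))"

text \<open>The operator is unique since \<open>df\<close> is injective, and it exists since \<open>d\<xi>(X)\<close> is
  tangent to the hypersurface.\<close>

definition shape_operator ::
    "('p, 'm::finite) chart set \<Rightarrow> ('p \<Rightarrow> real ^ 'k::finite) \<Rightarrow> ('p \<Rightarrow> real ^ 'k) \<Rightarrow>
     'p \<Rightarrow> real ^ 'm \<Rightarrow> real ^ 'm" where
  "shape_operator A f \<xi> x =
     (THE S. \<forall>X. differential A f x (S X) = - differential A \<xi> x X)"

definition principal_curvatures ::
    "('p, 'm::finite) chart set \<Rightarrow> ('p \<Rightarrow> real ^ 'k::finite) \<Rightarrow> ('p \<Rightarrow> real ^ 'k) \<Rightarrow>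
     'p \<Rightarrow> real set" where
  "principal_curvatures A f \<xi> x =
     {\<kappa>. \<exists>X. X \<noteq> 0 \<and> shape_operator A f \<xi> x X = \<kappa> *\<^sub>R X}"

definition isoparametric ::
    "'p topology \<Rightarrow> ('p, 'm::finite) chart set \<Rightarrow>
     ('p \<Rightarrow> real ^ 'k::finite) \<Rightarrow> ('p \<Rightarrow> real ^ 'k) \<Rightarrow> bool" where
  "isoparametric M A f \<xi> \<longleftrightarrow>
     oriented_hypersurface M A f \<xi> \<and>
     (\<forall>x\<in>topspace M. \<forall>y\<in>topspace M.
        principal_curvatures A f \<xi> x = principal_curvatures A f \<xi> y)"

definition legendre_lift ::
    "('p \<Rightarrow> real ^ 'k::finite) \<Rightarrow> ('p \<Rightarrow> real ^ 'k) \<Rightarrow> 'p \<Rightarrow> 'k lvec set set" where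
  "legendre_lift f \<xi> x = proj_line_through (1, f x, 0) (0, \<xi> x, 1)"

end

theory Submission
  imports Defs
begin

text \<open>On the line of \<open>Z = (1, f, 0)\<close> and \<open>W = (0, \<xi>, 1)\<close> the curvature spheres of a Legendre lift are
  the points \<open>[\<kappa> Z + W]\<close> with \<open>\<kappa>\<close> a principal curvature, and \<open>\<kappa> Z + W\<close> is orthogonal to
  \<open>(1, 0, -\<kappa>)\<close>. If the principal curvatures are constant, these points are fixed and lie on the
  timelike line spanned by \<open>(1, 0, 0)\<close> and \<open>(0, 0, 1)\<close>. Conversely, a Lie sphere transformation moves
  a given timelike line to that one, and the orthogonality relations then say that the ratio
  \<open>[r : s]\<close> is constant for each curvature sphere \<open>[r Z + s W]\<close>. A suitable rotation of the timelike
  plane avoids \<open>s = 0\<close>, so that \<open>f\<close> becomes an immersion.\<close>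

section \<open>Differential calculus\<close>

text \<open>The pairing of r (1, f, 0) + s (0, \<xi>, 1) with (a, 0, b) is -(r a + s b): f and \<xi>
  drop out, so a fixed point of the plane of outer coordinates prescribes a fixed ratio. The bad
  case is a = 0: the relation then forces s = 0, so (1, f, 0) is a curvature sphere and df has a
  kernel. As there are finitely many points, some vector of the timelike plane is orthogonal to none
  of them; moving it to the first axis makes every a nonzero. Geometrically, rotating the plane
  replaces the hypersurface by a parallel one. The labelling of the curvature spheres may change
  with the point in any way. Constancy is obtained for the set of principal curvatures: each sphere
  obeys the relation of some index, and each index is realised by some sphere. Two gaps separate the
  definitions from this computation. A Lie sphere transformation is only a projective map preserving
  the quadric, so its linear representative has to be shown to preserve the product up to a positive
  factor. Curvature spheres are defined through all frames at once, so they are compared with one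
  canonical pair f, \<xi>.\<close>

lemma Ck_on_cong:
  assumes "open S" "\<And>x. x \<in> S \<Longrightarrow> f x = g x" "Ck_on k S f"
  shows "Ck_on k S g"
  using assms(2,3)
proof (induction k arbitrary: f g)
  case 0
  then show ?case using continuous_on_cong[of S S f g] by simp
next
  case (Suc k)
  have der: "(g has_derivative frechet_derivative f (at x)) (at x)" if "x \<in> S" for x
  proof (rule has_derivative_transform_within_open[OF _ assms(1) that])
    show "(f has_derivative frechet_derivative f (at x)) (at x)"
      using Suc.prems(2) that by (simp add: frechet_derivative_works[symmetric])
  qed (use Suc.prems in auto)
  then have eq: "frechet_derivative g (at x) = frechet_derivative f (at x)" if "x \<in> S" for x
    using that frechet_derivative_at by metis
  have "Ck_on k S (\<lambda>x. frechet_derivative g (at x) v)" for v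
    using Suc.IH[of "\<lambda>x. frechet_derivative f (at x) v"] eq Suc.prems(2) by simp
  then show ?case using der by (auto simp: differentiable_def)
qed

text \<open>The recursion speaks of \<open>frechet_derivative\<close>, which is a choice. Uniqueness
  of derivatives lets any explicit formula take its place, which is how the sum, product and inverse
  rules enter below.\<close>

lemma Ck_on_SucI:
  assumes "open S" "\<And>x. x \<in> S \<Longrightarrow> (f has_derivative f' x) (at x)"
    and "\<And>v. Ck_on k S (\<lambda>x. f' x v)"
  shows "Ck_on (Suc k) S f"
proof -
  have "f' x = frechet_derivative f (at x)" if "x \<in> S" for x
    using frechet_derivative_at assms(2) that by blast
  then have "Ck_on k S (\<lambda>x. frechet_derivative f (at x) v)" for v
    using Ck_on_cong[OF assms(1) _ assms(3)[of v]] by simp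
  then show ?thesis using assms(2) by (auto simp: differentiable_def)
qed

lemma Ck_on_Suc_has_derivative:
  "Ck_on (Suc k) S f \<Longrightarrow> x \<in> S \<Longrightarrow> (f has_derivative frechet_derivative f (at x)) (at x)"
  by (simp add: frechet_derivative_works[symmetric])

text \<open>Level \<open>Suc k\<close> asks for differentiability and for derivatives of level k, so
  lower levels have to be rebuilt from level 0, where differentiability gives continuity. The
  product rule leaves undifferentiated factors, and these must drop one level.\<close>

lemma Ck_on_SucD: "Ck_on (Suc k) S f \<Longrightarrow> Ck_on k S f"
proof (induction k arbitrary: f)
  case 0
  then have "continuous (at x within S) f" if "x \<in> S" for x
    using that differentiable_imp_continuous_within continuous_at_imp_continuous_within
    by (metis Ck_on.simps(2))
  then show ?case by (simp add: continuous_on_eq_continuous_within)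
qed auto

lemma Ck_on_bounded_linear:
  assumes "open S" "bounded_linear L" "Ck_on k S f"
  shows "Ck_on k S (\<lambda>x. L (f x))"
  using assms(3)
proof (induction k arbitrary: f)
  case 0
  then show ?case using bounded_linear.continuous_on[OF assms(2)] by simp
next
  case (Suc k)
  show ?case
  proof (rule Ck_on_SucI[OF assms(1)])
    show "((\<lambda>x. L (f x)) has_derivative (\<lambda>v. L (frechet_derivative f (at x) v))) (at x)"
      if "x \<in> S" for x
      using bounded_linear.has_derivative[OF assms(2) Ck_on_Suc_has_derivative[OF Suc.prems that]] .
    show "Ck_on k S (\<lambda>x. L (frechet_derivative f (at x) v))" for v
      using Suc by simp
  qed
qed

lemma Ck_on_add:
  assumes "open S" "Ck_on k S f" "Ck_on k S g"
  shows "Ck_on k S (\<lambda>x. f x + g x)"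
  using assms(2,3)
proof (induction k arbitrary: f g)
  case 0
  then show ?case by (simp add: continuous_on_add)
next
  case (Suc k)
  show ?case
  proof (rule Ck_on_SucI[OF assms(1)])
    show "((\<lambda>x. f x + g x) has_derivative
        (\<lambda>v. frechet_derivative f (at x) v + frechet_derivative g (at x) v)) (at x)"
      if "x \<in> S" for x
      using has_derivative_add Ck_on_Suc_has_derivative Suc.prems that by blast
    show "Ck_on k S (\<lambda>x. frechet_derivative f (at x) v + frechet_derivative g (at x) v)" for v
      using Suc by simp
  qed
qed

lemma Ck_on_scaleR:
  fixes f :: "'a::real_normed_vector \<Rightarrow> real"
  assumes "open S" "Ck_on k S f" "Ck_on k S g"
  shows "Ck_on k S (\<lambda>x. f x *\<^sub>R g x)"
  using assms(2,3)
proof (induction k arbitrary: f g)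
  case 0
  then show ?case by (simp add: continuous_on_scaleR)
next
  case (Suc k)
  show ?case
  proof (rule Ck_on_SucI[OF assms(1)])
    show "((\<lambda>x. f x *\<^sub>R g x) has_derivative
        (\<lambda>v. f x *\<^sub>R frechet_derivative g (at x) v + frechet_derivative f (at x) v *\<^sub>R g x)) (at x)"
      if "x \<in> S" for x
      by (rule has_derivative_scaleR[OF Suc.prems[THEN Ck_on_Suc_has_derivative, OF that]])
    show "Ck_on k S (\<lambda>x. f x *\<^sub>R frechet_derivative g (at x) v + frechet_derivative f (at x) v *\<^sub>R g x)"
      for v
      using Suc.IH Suc.prems Ck_on_SucD[OF Suc.prems(1)] Ck_on_SucD[OF Suc.prems(2)]
      by (intro Ck_on_add[OF assms(1)]) auto
  qed
qed

text \<open>The derivative of 1/f is -(1/f)(1/f) f', which contains 1/f again but only at level k.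
  The induction hypothesis for the same f therefore suffices, together with the product
  rule.\<close>

lemma Ck_on_inverse:
  fixes f :: "'a::real_normed_vector \<Rightarrow> real"
  assumes "open S" "\<And>x. x \<in> S \<Longrightarrow> f x \<noteq> 0" "Ck_on k S f"
  shows "Ck_on k S (\<lambda>x. inverse (f x))"
  using assms(3)
proof (induction k)
  case 0
  then show ?case using assms(2) by (simp add: continuous_on_inverse)
next
  case (Suc k)
  have IH: "Ck_on k S (\<lambda>x. inverse (f x))" using Suc Ck_on_SucD by blast
  show ?case
  proof (rule Ck_on_SucI[OF assms(1)])
    show "((\<lambda>x. inverse (f x)) has_derivative
        (\<lambda>v. - (inverse (f x) *\<^sub>R inverse (f x) *\<^sub>R frechet_derivative f (at x) v))) (at x)"
      if "x \<in> S" for x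
      using Deriv.has_derivative_inverse[OF assms(2)[OF that] Ck_on_Suc_has_derivative[OF Suc.prems that]]
      by (simp add: mult_ac)
    show "Ck_on k S (\<lambda>x. - (inverse (f x) *\<^sub>R inverse (f x) *\<^sub>R frechet_derivative f (at x) v))"
      for v
    proof (rule Ck_on_bounded_linear[OF assms(1), of uminus])
      show "Ck_on k S (\<lambda>x. inverse (f x) *\<^sub>R inverse (f x) *\<^sub>R frechet_derivative f (at x) v)"
        using Suc.prems by (intro Ck_on_scaleR IH assms(1)) simp
    qed (rule bounded_linear_minus[OF bounded_linear_ident])
  qed
qed

section \<open>Smooth maps and differentials on a manifold, computed in charts\<close>

locale manifold =
  fixes M :: "'p topology" and A :: "('p, 'm::finite) chart set"
  assumes smooth_manifold: "smooth_manifold M A"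
begin

lemma chart: "c \<in> A \<Longrightarrow> is_chart M c"
  using smooth_manifold unfolding smooth_manifold_def by blast

lemma chart_subset: "c \<in> A \<Longrightarrow> fst c \<subseteq> topspace M"
  using chart[of c] openin_subset[of M "fst c"] by (simp add: is_chart_def split_beta)

lemma chart_image_open: "c \<in> A \<Longrightarrow> open (snd c ` fst c)"
  using chart[of c] by (simp add: is_chart_def split_beta)

lemma chart_inj:
  assumes "c \<in> A"
  shows "inj_on (snd c) (fst c)"
proof -
  have "homeomorphic_map (subtopology M (fst c)) (top_of_set (snd c ` fst c)) (snd c)"
    using chart[OF assms] by (simp add: is_chart_def split_beta)
  then have "inj_on (snd c) (topspace (subtopology M (fst c)))"
    by (simp only: homeomorphic_eq_everything_map)
  then show ?thesis using chart_subset[OF assms] by (simp add: inf.absorb2)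
qed

lemma in_chart_point: "y \<in> snd c ` fst c \<Longrightarrow> inv_into (fst c) (snd c) y \<in> fst c"
  by (rule inv_into_into)

lemma chart_at_mem:
  assumes "x \<in> topspace M"
  shows "chart_at A x \<in> A" "x \<in> fst (chart_at A x)"
proof -
  have "\<exists>c. c \<in> A \<and> x \<in> fst c" using assms smooth_manifold unfolding smooth_manifold_def by blast
  from someI_ex[OF this] show "chart_at A x \<in> A" "x \<in> fst (chart_at A x)"
    by (auto simp: chart_at_def)
qed

lemma smooth_map_iff:
  "smooth_map A F \<longleftrightarrow> (\<forall>c\<in>A. \<forall>k. Ck_on k (snd c ` fst c) (in_chart c F))"
  by (simp add: smooth_map_def smooth_on_def)

lemma smooth_map_bounded_linear:
  assumes "bounded_linear L" "smooth_map A F"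
  shows "smooth_map A (\<lambda>p. L (F p))"
  unfolding smooth_map_iff
proof (intro ballI allI)
  fix c k assume c: "c \<in> A"
  then have "Ck_on k (snd c ` fst c) (\<lambda>y. L (in_chart c F y))"
    using assms by (intro Ck_on_bounded_linear[OF chart_image_open assms(1)]) (auto simp: smooth_map_iff)
  then show "Ck_on k (snd c ` fst c) (in_chart c (\<lambda>p. L (F p)))"
    by (simp add: in_chart_def comp_def)
qed

lemma smooth_map_add:
  assumes "smooth_map A F" "smooth_map A G"
  shows "smooth_map A (\<lambda>p. F p + G p)"
  unfolding smooth_map_iff
proof (intro ballI allI)
  fix c k assume c: "c \<in> A"
  then have "Ck_on k (snd c ` fst c) (\<lambda>y. in_chart c F y + in_chart c G y)"
    using assms by (intro Ck_on_add chart_image_open) (auto simp: smooth_map_iff)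
  then show "Ck_on k (snd c ` fst c) (in_chart c (\<lambda>p. F p + G p))"
    by (simp add: in_chart_def comp_def)
qed

lemma smooth_map_diff:
  assumes "smooth_map A F" "smooth_map A G"
  shows "smooth_map A (\<lambda>p. F p - G p)"
  using smooth_map_add[OF assms(1) smooth_map_bounded_linear[OF _ assms(2), of uminus]]
  by (simp add: bounded_linear_minus)

lemma smooth_map_scaleR:
  assumes "smooth_map A a" "smooth_map A F"
  shows "smooth_map A (\<lambda>p. a p *\<^sub>R F p)"
  unfolding smooth_map_iff
proof (intro ballI allI)
  fix c k assume c: "c \<in> A"
  then have "Ck_on k (snd c ` fst c) (\<lambda>y. in_chart c a y *\<^sub>R in_chart c F y)"
    using assms by (intro Ck_on_scaleR chart_image_open) (auto simp: smooth_map_iff)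
  then show "Ck_on k (snd c ` fst c) (in_chart c (\<lambda>p. a p *\<^sub>R F p))"
    by (simp add: in_chart_def comp_def)
qed

lemma smooth_map_inverse:
  fixes a :: "'p \<Rightarrow> real"
  assumes "smooth_map A a" "\<And>p. p \<in> topspace M \<Longrightarrow> a p \<noteq> 0"
  shows "smooth_map A (\<lambda>p. inverse (a p))"
  unfolding smooth_map_iff
proof (intro ballI allI)
  fix c k assume c: "c \<in> A"
  have "in_chart c a y \<noteq> 0" if "y \<in> snd c ` fst c" for y
    using that in_chart_point[OF that] chart_subset[OF c] assms(2) by (auto simp: in_chart_def)
  then have "Ck_on k (snd c ` fst c) (\<lambda>y. inverse (in_chart c a y))"
    using c assms(1) by (intro Ck_on_inverse chart_image_open) (auto simp: smooth_map_iff)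
  then show "Ck_on k (snd c ` fst c) (in_chart c (\<lambda>p. inverse (a p)))"
    by (simp add: in_chart_def comp_def)
qed

context
  fixes x assumes x: "x \<in> topspace M"
begin

lemma differential_works:
  assumes "smooth_map A F"
  shows "(in_chart (chart_at A x) F has_derivative differential A F x) (at (snd (chart_at A x) x))"
proof -
  have "Ck_on (Suc 0) (snd (chart_at A x) ` fst (chart_at A x)) (in_chart (chart_at A x) F)"
    using assms chart_at_mem[OF x] unfolding smooth_map_iff by blast
  then show ?thesis using Ck_on_Suc_has_derivative chart_at_mem(2)[OF x]
    unfolding differential_def by blast
qed

lemma in_chart_at [simp]: "in_chart (chart_at A x) F (snd (chart_at A x) x) = F x"
  using chart_at_mem[OF x] chart_inj by (simp add: in_chart_def)

lemma differential_eqI: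
  assumes "(in_chart (chart_at A x) F has_derivative D) (at (snd (chart_at A x) x))"
  shows "differential A F x = D"
  using frechet_derivative_at[OF assms] by (simp add: differential_def)

lemma linear_differential: "smooth_map A F \<Longrightarrow> linear (differential A F x)"
  using differential_works has_derivative_linear by blast

text \<open>Identities such as f \<bullet> \<xi> = 0 are known on \<open>topspace M\<close> only.
  Charts lie inside it and have open images, so such identities may still be differentiated.\<close>

lemma differential_cong:
  assumes "smooth_map A F" "\<And>p. p \<in> topspace M \<Longrightarrow> F p = G p"
  shows "differential A G x = differential A F x"
proof (rule differential_eqI, rule has_derivative_transform_within_open[OF differential_works[OF assms(1)]])
  let ?c = "chart_at A x"
  show "open (snd ?c ` fst ?c)" "snd ?c x \<in> snd ?c ` fst ?c"
    using chart_at_mem[OF x] chart_image_open by auto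
  show "in_chart ?c F y = in_chart ?c G y" if "y \<in> snd ?c ` fst ?c" for y
    using in_chart_point[OF that] chart_subset[OF chart_at_mem(1)[OF x]] assms(2)
    by (auto simp: in_chart_def)
qed

lemma differential_const: "differential A (\<lambda>p. c) x X = 0"
  by (subst differential_eqI[of _ "\<lambda>_. 0"]) (auto simp: in_chart_def comp_def)

lemma differential_add:
  assumes "smooth_map A F" "smooth_map A G"
  shows "differential A (\<lambda>p. F p + G p) x X = differential A F x X + differential A G x X"
  using differential_eqI[of "\<lambda>p. F p + G p"]
    has_derivative_add[OF assms[THEN differential_works]]
  by (simp add: in_chart_def comp_def)

lemma differential_bounded_linear:
  assumes "bounded_linear L" "smooth_map A F"
  shows "differential A (\<lambda>p. L (F p)) x X = L (differential A F x X)"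
  using differential_eqI[of "\<lambda>p. L (F p)"]
    bounded_linear.has_derivative[OF assms(1) differential_works[OF assms(2)]]
  by (simp add: in_chart_def comp_def)

lemma differential_scaleR:
  assumes "smooth_map A a" "smooth_map A F"
  shows "differential A (\<lambda>p. a p *\<^sub>R F p) x X =
    a x *\<^sub>R differential A F x X + differential A a x X *\<^sub>R F x"
proof -
  have "differential A (\<lambda>p. a p *\<^sub>R F p) x =
      (\<lambda>X. a x *\<^sub>R differential A F x X + differential A a x X *\<^sub>R F x)"
    using has_derivative_scaleR[OF assms[THEN differential_works]]
    by (intro differential_eqI) (simp only: in_chart_at, simp add: in_chart_def comp_def)
  then show ?thesis by simp
qed

lemma differential_inner:
  fixes F G :: "'p \<Rightarrow> 'b::real_inner"
  assumes "smooth_map A F" "smooth_map A G"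
  shows "differential A (\<lambda>p. F p \<bullet> G p) x X =
    F x \<bullet> differential A G x X + differential A F x X \<bullet> G x"
proof -
  have "differential A (\<lambda>p. F p \<bullet> G p) x =
      (\<lambda>X. F x \<bullet> differential A G x X + differential A F x X \<bullet> G x)"
    using has_derivative_inner[OF assms[THEN differential_works]]
    by (intro differential_eqI) (simp only: in_chart_at, simp add: in_chart_def comp_def)
  then show ?thesis by simp
qed

text \<open>Applied to a unit field paired with itself, this shows that its differential is
  orthogonal to it. Applied to f and \<xi>, it moves the derivative from one factor to the
  other.\<close>

lemma differential_inner_const:
  fixes F G :: "'p \<Rightarrow> 'b::real_inner"
  assumes "smooth_map A F" "smooth_map A G" "\<And>p. p \<in> topspace M \<Longrightarrow> F p \<bullet> G p = c"
  shows "differential A F x X \<bullet> G x = - (F x \<bullet> differential A G x X)"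
proof -
  have "smooth_map A (\<lambda>p. c)"
    unfolding smooth_map_iff
  proof (intro ballI allI)
    fix ch :: "('p, 'm) chart" and k assume "ch \<in> A"
    \<comment> \<open>The derivative of any constant is the zero constant, so zero has to be settled
      before c.\<close>
    have "Ck_on k S (\<lambda>x. 0)" for S :: "(real ^ 'm) set"
      by (induction k) auto
    then have "Ck_on k S (\<lambda>x. c)" for S :: "(real ^ 'm) set"
      by (cases k) auto
    then show "Ck_on k (snd ch ` fst ch) (in_chart ch (\<lambda>p. c))" by (simp add: in_chart_def comp_def)
  qed
  then have "differential A (\<lambda>p. F p \<bullet> G p) x = differential A (\<lambda>p. c) x"
    by (rule differential_cong) (simp add: assms)
  then have "differential A (\<lambda>p. F p \<bullet> G p) x X = 0" by (simp add: differential_const)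
  then show ?thesis using differential_inner[OF assms(1,2)] by simp
qed

end

end

section \<open>Linear algebra of the Lie scalar product\<close>

declare split_paired_All [simp del] split_paired_Ex [simp del]

lemma mem_span_pair:
  fixes u v :: "'a::real_vector"
  shows "z \<in> span {u, v} \<longleftrightarrow> (\<exists>a b. z = a *\<^sub>R u + b *\<^sub>R v)"
proof -
  have "z \<in> span {u, v} \<longleftrightarrow> (\<exists>a b. z - a *\<^sub>R u = b *\<^sub>R v)"
    by (auto simp: span_breakdown_eq span_singleton)
  then show ?thesis by (simp add: diff_eq_eq add.commute)
qed

lemma lin_indep2_iff:
  "lin_indep2 u v \<longleftrightarrow> (\<forall>a b. a *\<^sub>R u + b *\<^sub>R v = 0 \<longrightarrow> a = 0 \<and> b = 0)"
proof
  assume "lin_indep2 u v"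
  then have uv: "v \<noteq> 0" "\<And>k. u \<noteq> k *\<^sub>R v"
    by (auto simp: lin_indep2_def independent_insert span_singleton split: if_splits)
  show "\<forall>a b. a *\<^sub>R u + b *\<^sub>R v = 0 \<longrightarrow> a = 0 \<and> b = 0"
  proof (intro allI impI)
    fix a b assume eq: "a *\<^sub>R u + b *\<^sub>R v = 0"
    have "a = 0"
    proof (rule ccontr)
      assume "a \<noteq> 0"
      have "u = inverse a *\<^sub>R (a *\<^sub>R u)" using \<open>a \<noteq> 0\<close> by simp
      also have "a *\<^sub>R u = (- b) *\<^sub>R v" using eq by (simp add: eq_neg_iff_add_eq_0)
      finally show False using uv(2) by (metis scaleR_scaleR)
    qed
    then show "a = 0 \<and> b = 0" using eq uv by simp
  qed
next
  assume *: "\<forall>a b. a *\<^sub>R u + b *\<^sub>R v = 0 \<longrightarrow> a = 0 \<and> b = 0"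
  have "v \<noteq> 0" using *[rule_format, of 0 1] by auto
  moreover have "u \<noteq> k *\<^sub>R v" for k using *[rule_format, of 1 "- k"] by auto
  ultimately show "lin_indep2 u v"
    using \<open>\<And>k. u \<noteq> k *\<^sub>R v\<close>[of 1]
    by (auto simp: lin_indep2_def independent_insert span_singleton)
qed

lemma proj_eqD: "proj x = proj y \<Longrightarrow> \<exists>k. x = k *\<^sub>R y"
  using span_base[of x "{x}"] by (auto simp: proj_def span_singleton)

lemma proj_scaleR:
  assumes "k \<noteq> 0"
  shows "proj (k *\<^sub>R x) = proj x"
proof -
  have "c *\<^sub>R x = (c / k) *\<^sub>R (k *\<^sub>R x)" for c using assms by simp
  then have "c *\<^sub>R x \<in> range (\<lambda>c. c *\<^sub>R (k *\<^sub>R x))" for c by (rule range_eqI)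
  then show ?thesis unfolding proj_def span_singleton by auto
qed

text \<open>Frames are handled through planes of vectors, while \<open>Lambda\<close> consists of
  sets of projective points. A point determines its nonzero vectors up to a scalar, and 0 lies in
  both spans.\<close>

lemma span_pair_eq_iff_proj_line:
  "proj_line_through u v = proj_line_through u' v' \<longleftrightarrow> span {u, v} = span {u', v'}"
proof
  have sub: "span {u, v} \<subseteq> span {u', v'}"
    if "proj_line_through u v = proj_line_through u' v'" for u v u' v' :: "'k::finite lvec"
  proof
    fix z assume z: "z \<in> span {u, v}"
    show "z \<in> span {u', v'}"
    proof (cases "z = 0")
      case False
      then have "proj z \<in> proj_line_through u' v'"
        using z that[symmetric] by (auto simp: proj_line_through_def)
      then obtain z' where "z' \<in> span {u', v'}" "proj z = proj z'"
        by (auto simp: proj_line_through_def)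
      then show ?thesis using proj_eqD span_scale by metis
    qed (simp add: span_zero)
  qed
  assume "proj_line_through u v = proj_line_through u' v'"
  then show "span {u, v} = span {u', v'}" using sub[of u v u' v'] sub[of u' v' u v] by auto
qed (simp add: proj_line_through_def)

lemma lie_prod_simps [simp]:
  "lie_prod (a, v, b) (a', v', b') = - (a * a') + v \<bullet> v' - b * b'"
  by (simp add: lie_prod_def)

lemma lie_prod_commute: "lie_prod x y = lie_prod y x"
  by (cases x; cases y) (simp add: inner_commute)

lemma lie_prod_add_left: "lie_prod (x + y) z = lie_prod x z + lie_prod y z"
  by (cases x; cases y; cases z) (simp add: algebra_simps)

lemma lie_prod_scaleR_left: "lie_prod (k *\<^sub>R x) z = k * lie_prod x z"
  by (cases x; cases z) (simp add: algebra_simps)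

lemma lie_prod_add_right: "lie_prod z (x + y) = lie_prod z x + lie_prod z y"
  by (simp add: lie_prod_commute[of z] lie_prod_add_left)

lemma lie_prod_scaleR_right: "lie_prod z (k *\<^sub>R x) = k * lie_prod z x"
  by (simp add: lie_prod_commute[of z] lie_prod_scaleR_left)

lemma lie_prod_diff_left: "lie_prod (x - y) z = lie_prod x z - lie_prod y z"
  by (cases x; cases y; cases z) (simp add: algebra_simps)

lemma lie_prod_diff_right: "lie_prod z (x - y) = lie_prod z x - lie_prod z y"
  by (simp add: lie_prod_commute[of z] lie_prod_diff_left)

lemma lie_prod_zero [simp]: "lie_prod 0 x = 0" "lie_prod x 0 = 0"
  using lie_prod_scaleR_left[of 0 0 x] lie_prod_scaleR_right[of x 0 0] by auto

lemmas lie_prod_bilinear = lie_prod_add_left lie_prod_add_right lie_prod_diff_left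
  lie_prod_diff_right lie_prod_scaleR_left lie_prod_scaleR_right

text \<open>A linear representative of a projective transformation is fixed only up to a nonzero
  scalar, hence the factor c. Its positivity keeps timelike vectors timelike.\<close>

definition lie_similarity :: "real \<Rightarrow> ('k::finite lvec \<Rightarrow> 'k lvec) \<Rightarrow> bool" where
  "lie_similarity c B \<longleftrightarrow>
     linear B \<and> bij B \<and> c > 0 \<and> (\<forall>x y. lie_prod (B x) (B y) = c * lie_prod x y)"

lemma image_proj: "linear B \<Longrightarrow> B ` proj x = proj (B x)"
  by (simp add: proj_def linear_span_image[symmetric])

lemma image_span_pair: "linear B \<Longrightarrow> B ` span {u, v} = span {B u, B v}"
  by (simp add: linear_span_image[symmetric])

lemma image_proj_line:
  assumes "linear B" "bij B" "\<And>x. x \<noteq> 0 \<Longrightarrow> \<beta> (proj x) = proj (B x)"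
  shows "\<beta> ` proj_line_through u v = proj_line_through (B u) (B v)"
proof -
  have nz: "B x \<noteq> 0 \<longleftrightarrow> x \<noteq> 0" for x
    using assms(1,2) by (metis bij_is_inj injD linear_0)
  have "\<beta> ` proj_line_through u v = {proj (B z) | z. z \<in> span {u, v} \<and> z \<noteq> 0}"
    using assms(3) unfolding proj_line_through_def by fastforce
  also have "\<dots> = {proj y | y. y \<in> B ` span {u, v} \<and> y \<noteq> 0}"
    using nz by blast
  finally show ?thesis using image_span_pair[OF assms(1)] by (simp add: proj_line_through_def)
qed

lemma lie_quadric_proj_iff:
  assumes "x \<noteq> 0"
  shows "proj x \<in> lie_quadric \<longleftrightarrow> lie_prod x x = 0"
proof
  assume "proj x \<in> lie_quadric"
  then obtain y where "proj x = proj y" "lie_prod y y = 0" by (auto simp: lie_quadric_def)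
  then show "lie_prod x x = 0" using proj_eqD[of x y] by (auto simp: lie_prod_bilinear)
qed (use assms in \<open>auto simp: lie_quadric_def\<close>)

lemma lie_similarity_transformation:
  fixes B :: "'k::finite lvec \<Rightarrow> 'k lvec"
  assumes "lie_similarity c B"
  shows "lie_sphere_transformation (image B)"
proof -
  have B: "linear B" "bij B" "c > 0" "\<And>x y. lie_prod (B x) (B y) = c * lie_prod x y"
    using assms by (auto simp: lie_similarity_def)
  have nz: "B x = 0 \<longleftrightarrow> x = 0" for x
    using B by (metis bij_is_inj injD linear_0)
  have "image B ` lie_quadric = {proj (B x) | x. x \<noteq> 0 \<and> lie_prod x x = 0}"
    unfolding lie_quadric_def image_proj[OF B(1), symmetric] by blast
  also have "\<dots> = {proj (B x) | x. B x \<noteq> 0 \<and> lie_prod (B x) (B x) = 0}"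
    using B(3,4) nz by simp
  also have "\<dots> = lie_quadric"
  proof -
    have "\<exists>x. y = B x" for y using bij_is_surj[OF B(2)] surjD by metis
    then show ?thesis unfolding lie_quadric_def by (intro Collect_cong) metis
  qed
  finally show ?thesis
    using B(1,2) image_proj[OF B(1)]
    unfolding lie_sphere_transformation_def projective_transformation_def by blast
qed

text \<open>Isotropic vectors have the form \<open>(a, v, b)\<close> with \<open>(a, b)\<close> and \<open>v\<close> of equal length.
  Flipping the sign of \<open>v\<close> kills the mixed terms of any form vanishing on them, and separate
  rotations of \<open>(a, b)\<close> and \<open>v\<close> show that the form is proportional to the Lie product.
  The factor is positive since a negative definite subspace has dimension at most two.\<close>

lemma lie_sphere_transformation_similarity:
  fixes \<beta> :: "'k::finite lvec set \<Rightarrow> 'k lvec set"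
  assumes "lie_sphere_transformation \<beta>" and card: "CARD('k) \<ge> 3"
  obtains c B where "lie_similarity c B" "\<And>x. x \<noteq> 0 \<Longrightarrow> \<beta> (proj x) = proj (B x)"
proof -
  obtain B where B: "linear B" "bij B" "\<And>x. x \<noteq> 0 \<Longrightarrow> \<beta> (proj x) = proj (B x)"
    using assms(1) by (auto simp: lie_sphere_transformation_def projective_transformation_def)
  define q where "q x y = lie_prod (B x) (B y)" for x y
  have q_add: "q (x + y) z = q x z + q y z" "q z (x + y) = q z x + q z y" for x y z
    by (simp_all add: q_def linear_add[OF B(1)] lie_prod_bilinear)
  have q_scale: "q (k *\<^sub>R x) z = k * q x z" "q z (k *\<^sub>R x) = k * q z x" for k x z
    by (simp_all add: q_def linear_scale[OF B(1)] lie_prod_bilinear)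
  have q_commute: "q x y = q y x" for x y by (simp add: q_def lie_prod_commute)
  have null: "q x x = 0" if "lie_prod x x = 0" for x
  proof (cases "x = 0")
    case False
    then have "B x \<noteq> 0" using B by (metis bij_is_inj injD linear_0)
    moreover have "proj (B x) \<in> lie_quadric"
      using assms(1) False that B(3)[OF False] lie_quadric_proj_iff[OF False]
      by (auto simp: lie_sphere_transformation_def)
    ultimately show ?thesis by (simp add: q_def lie_quadric_proj_iff)
  qed (simp add: q_def linear_0[OF B(1)])
  define T where "T t = (fst t, 0 :: real ^ 'k, snd t)" for t :: "real \<times> real"
  define V where "V v = (0 :: real, v, 0 :: real)" for v :: "real ^ 'k"
  have T_scale: "T (k *\<^sub>R t) = k *\<^sub>R T t" for k t by (simp add: T_def)
  have V_scale: "V (k *\<^sub>R v) = k *\<^sub>R V v" for k v by (simp add: V_def)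
  have split: "x = T (fst x, snd (snd x)) + V (fst (snd x))" for x
    by (cases x) (simp add: T_def V_def)
  have eqs: "q (T t) (V v) = 0 \<and> q (T t) (T t) = - q (V v) (V v)" if "norm t = norm v" for t v
  proof -
    have n: "fst t * fst t + snd t * snd t = v \<bullet> v"
      using that by (cases t) (simp add: norm_Pair norm_eq_sqrt_inner power2_eq_square)
    have plus: "q (T t + V v) (T t + V v) = 0"
      by (rule null) (use n in \<open>simp add: T_def V_def\<close>)
    have minus: "q (T t + (-1) *\<^sub>R V v) (T t + (-1) *\<^sub>R V v) = 0"
      by (rule null) (use n in \<open>simp add: T_def V_def\<close>)
    show ?thesis
      using plus minus q_commute[of "V v" "T t"] unfolding q_add q_scale
      by (auto simp: algebra_simps)
  qed
  \<comment> \<open>Each v is compared with the multiple \<open>norm v *\<^sub>R t0\<close> of one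
    fixed unit vector, so \<open>q\<close> on the middle part depends on the length alone. Each t is
    then compared with any v of its own length.\<close>
  define t0 where "t0 = (1 :: real, 0 :: real)"
  define c where "c = - q (T t0) (T t0)"
  have "norm t0 = 1" by (simp add: t0_def norm_Pair)
  have mixed: "q (T t) (V v) = 0" for t v
  proof (cases "t = 0 \<or> v = 0")
    case True
    then show ?thesis
      using q_scale(1)[of 0 "T t" "V v"] q_scale(2)[of "T t" 0 "V v"] T_scale[of 0 t] V_scale[of 0 v]
      by auto
  next
    case False
    then have "q (T (inverse (norm t) *\<^sub>R t)) (V (inverse (norm v) *\<^sub>R v)) = 0"
      by (intro eqs[THEN conjunct1]) simp
    then show ?thesis using False by (simp add: T_scale V_scale q_scale)
  qed
  have qV: "q (V v) (V v) = c * (v \<bullet> v)" for v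
  proof -
    have "norm (norm v *\<^sub>R t0) = norm v" using \<open>norm t0 = 1\<close> by simp
    from eqs[OF this] show ?thesis
      by (simp add: T_scale q_scale c_def power2_norm_eq_inner[symmetric] power2_eq_square mult_ac)
  qed
  have qT: "q (T t) (T t) = - c * (t \<bullet> t)" for t
  proof -
    obtain v :: "real ^ 'k" where "norm v = norm t" using vector_choose_size[of "norm t"] by auto
    from eqs[OF this[symmetric]] show ?thesis
      using \<open>norm v = norm t\<close> by (simp add: qV power2_norm_eq_inner[symmetric])
  qed
  have qq: "q x x = c * lie_prod x x" for x
  proof -
    have "q x x = q (T (fst x, snd (snd x)) + V (fst (snd x))) (T (fst x, snd (snd x)) + V (fst (snd x)))"
      using split[of x] by simp
    also have "\<dots> = c * lie_prod x x"
      using mixed q_commute[of "V _" "T _"] by (cases x) (simp add: q_add qT qV algebra_simps)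
    finally show ?thesis .
  qed
  have sim: "q x y = c * lie_prod x y" for x y
    using qq[of "x + y"] qq[of x] qq[of y] q_commute[of x y] lie_prod_commute[of x y]
    by (simp add: q_add lie_prod_bilinear algebra_simps)
  have "c > 0"
  proof -
    \<comment> \<open>\<open>h\<close> reads off the two negative coordinates of the image of the
      middle part. That part has dimension at least 3, so \<open>h\<close> kills some v \<noteq> 0;
      the image of v is then a nonzero vector (0, w, 0) of positive norm, which fixes the sign of
      c.\<close>
    define h where "h v = (fst (B (V v)), snd (snd (B (V v))))" for v
    have "linear V" by (auto simp: V_def intro!: linearI)
    then have "linear h"
      using B(1) by (auto simp: h_def linear_add linear_scale intro!: linearI)
    have "\<not> inj h"
    proof
      assume "inj h"
      then have "dim (h ` UNIV) = dim (UNIV :: (real ^ 'k) set)"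
        using \<open>linear h\<close> by (intro dim_image_eq) auto
      moreover have "dim (h ` UNIV) \<le> 2"
        using dim_subset_UNIV[of "h ` UNIV"] by simp
      ultimately show False using card by simp
    qed
    then obtain v where v: "v \<noteq> 0" "h v = 0"
      using \<open>linear h\<close> linear_injective_0 by blast
    then obtain w where w: "B (V v) = (0, w, 0)"
      by (cases "B (V v)") (auto simp: h_def zero_prod_def)
    have "V v \<noteq> 0" using v by (simp add: V_def zero_prod_def)
    then have "B (V v) \<noteq> 0" using B by (metis bij_is_inj injD linear_0)
    then have "w \<noteq> 0" using w by (auto simp: zero_prod_def)
    then have "0 < q (V v) (V v)" by (simp add: q_def w)
    then show ?thesis using qV[of v] inner_ge_zero[of v] by (simp add: zero_less_mult_iff)
  qed
  then have "lie_similarity c B" using B sim by (simp add: lie_similarity_def q_def)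
  then show thesis using B(3) that by blast
qed

lemma lie_similarity_inv:
  assumes "lie_similarity c B"
  shows "lie_prod (inv B x) (inv B y) = lie_prod x y / c"
proof -
  have "lie_prod (B (inv B x)) (B (inv B y)) = c * lie_prod (inv B x) (inv B y)" "c > 0" "surj B"
    using assms by (simp_all add: lie_similarity_def bij_is_surj)
  then show ?thesis by (simp add: surj_f_inv_f)
qed

section \<open>Reflections and normal forms of timelike planes\<close>

definition reflection :: "'k::finite lvec \<Rightarrow> 'k lvec \<Rightarrow> 'k lvec" where
  "reflection u x = x - (2 * lie_prod x u / lie_prod u u) *\<^sub>R u"

lemma lie_similarity_reflection:
  assumes "lie_prod u u \<noteq> 0"
  shows "lie_similarity 1 (reflection u)"
proof -
  have lin: "linear (reflection u)"
  proof (rule linearI)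
    show "reflection u (x + y) = reflection u x + reflection u y" for x y
      by (simp add: reflection_def lie_prod_add_left add_divide_distrib distrib_left scaleR_add_left)
    show "reflection u (k *\<^sub>R x) = k *\<^sub>R reflection u x" for k x
      by (simp add: reflection_def lie_prod_scaleR_left scaleR_diff_right mult.left_commute)
  qed
  have "reflection u (reflection u x) = x" for x
    using assms by (simp add: reflection_def lie_prod_bilinear algebra_simps)
  then have "bij (reflection u)" by (intro o_bij[of "reflection u"]) auto
  moreover have "lie_prod (reflection u x) (reflection u y) = lie_prod x y" for x y
  proof -
    define r s where rs: "r = lie_prod x u" "s = lie_prod y u"
    let ?U = "lie_prod u u"
    have "lie_prod (reflection u x) (reflection u y) =
        lie_prod x y - (2 * s / ?U) * r - (2 * r / ?U) * (s - (2 * s / ?U) * ?U)"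
      by (simp add: reflection_def lie_prod_bilinear lie_prod_commute[of u y] rs)
    also have "\<dots> = lie_prod x y" using assms by simp
    finally show ?thesis .
  qed
  ultimately show ?thesis using lin by (simp add: lie_similarity_def)
qed

text \<open>Equal norms give 2<x, x - y> = <x - y, x - y>, so the coefficient in the reflection is 1
  and exactly x - y is subtracted from x.\<close>

lemma reflection_diff:
  assumes "lie_prod x x = lie_prod y y" "lie_prod (x - y) (x - y) \<noteq> 0"
  shows "reflection (x - y) x = y"
proof -
  have "2 * lie_prod x (x - y) = lie_prod (x - y) (x - y)"
    using assms(1) by (simp add: lie_prod_bilinear lie_prod_commute)
  then show ?thesis using assms(2) by (simp add: reflection_def)
qed

lemma lie_similarity_comp:
  "lie_similarity c B \<Longrightarrow> lie_similarity d C \<Longrightarrow> lie_similarity (d * c) (C \<circ> B)"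
  by (auto simp: lie_similarity_def linear_compose bij_comp)

text \<open>In an indefinite space x - y may be isotropic and then defines no reflection. Here <x -
  \<epsilon> y, x - \<epsilon> y> = -2 - 2 \<epsilon> <x, y>: the sign \<epsilon> = 1 fails only for
  <x, y> = -1, and there \<epsilon> = -1 gives -4.\<close>

lemma reflection_to_timelike:
  assumes "lie_prod x x = -1" "lie_prod y y = -1"
  obtains \<epsilon> where "\<epsilon> = 1 \<or> \<epsilon> = -1" "lie_prod (x - \<epsilon> *\<^sub>R y) (x - \<epsilon> *\<^sub>R y) \<noteq> 0"
    "reflection (x - \<epsilon> *\<^sub>R y) x = \<epsilon> *\<^sub>R y"
proof -
  define \<epsilon> :: real where "\<epsilon> = (if lie_prod x y = -1 then -1 else 1)"
  have nz: "lie_prod (x - \<epsilon> *\<^sub>R y) (x - \<epsilon> *\<^sub>R y) \<noteq> 0"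
    using assms by (auto simp: lie_prod_bilinear \<epsilon>_def lie_prod_commute[of y x])
  moreover have "lie_prod x x = lie_prod (\<epsilon> *\<^sub>R y) (\<epsilon> *\<^sub>R y)"
    using assms by (simp add: lie_prod_bilinear \<epsilon>_def)
  ultimately show thesis
    using that[of \<epsilon>] reflection_diff[of x "\<epsilon> *\<^sub>R y"] by (auto simp: \<epsilon>_def)
qed

text \<open>A case of Witt's theorem, by two reflections. The second one leaves the image of T1 in
  place, because its mirror vector \<open>R T2 - \<delta> *\<^sub>R ?e'\<close> is a difference of
  two vectors orthogonal to that image. The signs \<epsilon>, \<delta> are those needed to avoid
  isotropic mirror vectors.\<close>

lemma timelike_plane_normal_form:
  fixes T1 T2 :: "'k::finite lvec"
  assumes "lie_prod T1 T1 = -1" "lie_prod T2 T2 = -1" "lie_prod T1 T2 = 0"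
  obtains B \<epsilon> \<delta> where "lie_similarity 1 B" "\<epsilon> = 1 \<or> \<epsilon> = -1" "\<delta> = 1 \<or> \<delta> = -1"
    "B T1 = (\<epsilon>, 0, 0)" "B T2 = (0, 0, \<delta>)"
proof -
  let ?e = "(1, 0, 0) :: 'k lvec" and ?e' = "(0, 0, 1) :: 'k lvec"
  obtain \<epsilon> where \<epsilon>: "\<epsilon> = 1 \<or> \<epsilon> = -1" "lie_prod (T1 - \<epsilon> *\<^sub>R ?e) (T1 - \<epsilon> *\<^sub>R ?e) \<noteq> 0"
    "reflection (T1 - \<epsilon> *\<^sub>R ?e) T1 = \<epsilon> *\<^sub>R ?e"
    using reflection_to_timelike[of T1 ?e] assms by auto
  define R where "R = reflection (T1 - \<epsilon> *\<^sub>R ?e)"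
  have R: "lie_similarity 1 R" unfolding R_def using \<epsilon>(2) by (rule lie_similarity_reflection)
  then have R_prod: "lie_prod (R x) (R y) = lie_prod x y" for x y by (simp add: lie_similarity_def)
  have "lie_prod (R T2) (R T2) = -1" using R_prod assms by simp
  then obtain \<delta> where \<delta>: "\<delta> = 1 \<or> \<delta> = -1"
    "lie_prod (R T2 - \<delta> *\<^sub>R ?e') (R T2 - \<delta> *\<^sub>R ?e') \<noteq> 0"
    "reflection (R T2 - \<delta> *\<^sub>R ?e') (R T2) = \<delta> *\<^sub>R ?e'"
    using reflection_to_timelike[of "R T2" ?e'] by auto
  have "lie_prod (R T1) (R T2) = 0" using R_prod assms by simp
  then have "lie_prod (R T1) (R T2 - \<delta> *\<^sub>R ?e') = 0"
    using \<epsilon>(3) by (simp add: R_def lie_prod_diff_right)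
  then have "reflection (R T2 - \<delta> *\<^sub>R ?e') (R T1) = R T1" by (simp add: reflection_def)
  then show thesis
    using that[of "reflection (R T2 - \<delta> *\<^sub>R ?e') \<circ> R" \<epsilon> \<delta>] \<epsilon> \<delta>
      lie_similarity_comp[OF R lie_similarity_reflection[OF \<delta>(2)]]
    by (simp add: R_def)
qed

text \<open>Rescaling a vector by k multiplies its norm by a square, so the sign seen on one
  representative of a point holds for all of them, and the plane is negative definite.\<close>

lemma timelike_line_span:
  assumes "timelike_line L"
  obtains x y where "lin_indep2 x y" "L = proj_line_through x y"
    "\<And>z. z \<in> span {x, y} \<Longrightarrow> z \<noteq> 0 \<Longrightarrow> lie_prod z z < 0"
proof -
  obtain x y where xy: "lin_indep2 x y" "L = proj_line_through x y"
    using assms by (auto simp: timelike_line_def is_proj_line_def)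
  have "lie_prod z z < 0" if "z \<in> span {x, y}" "z \<noteq> 0" for z
  proof -
    have "proj z \<in> L" using that xy by (auto simp: proj_line_through_def)
    then obtain w where "proj z = proj w" "lie_prod w w < 0"
      using assms by (auto simp: timelike_line_def timelike_point_def)
    moreover then obtain k where "z = k *\<^sub>R w" using proj_eqD by blast
    ultimately show ?thesis
      using that(2) by (auto simp: lie_prod_bilinear mult.assoc[symmetric] mult_less_0_iff
          zero_less_mult_iff linorder_neq_iff)
  qed
  with xy show thesis using that by blast
qed

lemma proj_line_through_mem:
  assumes "P \<noteq> 0"
  shows "proj P \<in> proj_line_through x y \<longleftrightarrow> P \<in> span {x, y}"
proof
  assume "proj P \<in> proj_line_through x y"
  then obtain z where "z \<in> span {x, y}" "proj P = proj z" by (auto simp: proj_line_through_def)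
  then show "P \<in> span {x, y}" using proj_eqD span_scale by metis
qed (use assms in \<open>auto simp: proj_line_through_def\<close>)

text \<open>The vector sent to the first axis is chosen non-orthogonal to all \<open>P i\<close>, which is possible since
  each \<open>P i\<close> excludes at most one direction of the plane.\<close>

lemma timelike_line_normal_form:
  fixes P :: "nat \<Rightarrow> 'k::finite lvec"
  assumes "timelike_line L" "finite I" "\<And>i. i \<in> I \<Longrightarrow> P i \<noteq> 0 \<and> proj (P i) \<in> L"
  obtains B a b where "lie_similarity 1 B" "\<And>i. i \<in> I \<Longrightarrow> B (P i) = (a i, 0, b i) \<and> a i \<noteq> 0"
proof -
  obtain x y where xy: "lin_indep2 x y" "L = proj_line_through x y"
    and neg: "\<And>z. z \<in> span {x, y} \<Longrightarrow> z \<noteq> 0 \<Longrightarrow> lie_prod z z < 0"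
    using timelike_line_span[OF assms(1)] by metis
  have P: "P i \<in> span {x, y}" if "i \<in> I" for i
    using assms(3)[OF that] xy(2) proj_line_through_mem by blast
  have "finite ((\<lambda>i. - lie_prod (P i) x / lie_prod (P i) y) ` I)" using assms(2) by simp
  then obtain t where t: "t \<notin> (\<lambda>i. - lie_prod (P i) x / lie_prod (P i) y) ` I"
    using ex_new_if_finite[OF infinite_UNIV_char_0] by blast
  define u where "u = x + t *\<^sub>R y"
  have Pu: "lie_prod (P i) u \<noteq> 0" if i: "i \<in> I" for i
  proof
    assume "lie_prod (P i) u = 0"
    then have eq: "lie_prod (P i) x + t * lie_prod (P i) y = 0"
      by (simp add: u_def lie_prod_bilinear)
    show False
    proof (cases "lie_prod (P i) y = 0")
      case True
      then have "lie_prod (P i) x = 0" using eq by simp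
      moreover obtain p q where "P i = p *\<^sub>R x + q *\<^sub>R y" using P[OF i] mem_span_pair by metis
      ultimately have "lie_prod (P i) (P i) = 0"
        using True lie_prod_add_right lie_prod_scaleR_right by (metis add_0 mult_zero_right)
      then show False using neg[OF P[OF i]] assms(3)[OF i] by simp
    next
      case False
      then have "t = - lie_prod (P i) x / lie_prod (P i) y" using eq by (simp add: field_simps)
      then show False using t i by blast
    qed
  qed
  \<comment> \<open>Gram-Schmidt: w completes u to an orthogonal basis of the plane.\<close>
  define k where "k = lie_prod y u / lie_prod u u"
  define w where "w = y - k *\<^sub>R u"
  have u: "u \<in> span {x, y}" "u \<noteq> 0"
    using xy(1) unfolding u_def lin_indep2_iff mem_span_pair by (metis scaleR_one, metis scaleR_one zero_neq_one)
  have w: "w \<in> span {x, y}" "w \<noteq> 0"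
  proof -
    have eq: "w = (- k) *\<^sub>R x + (1 - k * t) *\<^sub>R y" by (simp add: w_def u_def algebra_simps)
    then show "w \<in> span {x, y}" using mem_span_pair by blast
    show "w \<noteq> 0"
    proof
      assume "w = 0"
      with eq xy(1) have "- k = 0 \<and> 1 - k * t = 0" unfolding lin_indep2_iff by metis
      then show False by auto
    qed
  qed
  have uu: "lie_prod u u < 0" and ww: "lie_prod w w < 0" using neg u w by auto
  have uw: "lie_prod u w = 0"
    using uu by (simp add: w_def k_def lie_prod_bilinear lie_prod_commute[of u y])
  define T1 where "T1 = inverse (sqrt (- lie_prod u u)) *\<^sub>R u"
  define T2 where "T2 = inverse (sqrt (- lie_prod w w)) *\<^sub>R w"
  have sq: "inverse (sqrt (- s)) * (inverse (sqrt (- s)) * s) = -1" if "s < 0" for s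
  proof -
    have "sqrt (- s) * sqrt (- s) = - s" using that by simp
    then show ?thesis using that by (simp add: field_simps)
  qed
  have T: "lie_prod T1 T1 = -1" "lie_prod T2 T2 = -1" "lie_prod T1 T2 = 0"
    using uu ww uw sq by (simp_all add: T1_def T2_def lie_prod_bilinear)
  obtain B \<epsilon> \<delta> where B: "lie_similarity 1 B" "\<epsilon> = 1 \<or> \<epsilon> = -1" "\<delta> = 1 \<or> \<delta> = -1"
    "B T1 = (\<epsilon>, 0, 0)" "B T2 = (0, 0, \<delta>)"
    using timelike_plane_normal_form[OF T] by metis
  have lin: "linear B" and B_prod: "lie_prod (B x) (B y) = lie_prod x y" for x y
    using B(1) by (auto simp: lie_similarity_def)
  have mid: "fst (snd (B v)) = 0" if v: "v \<in> span {x, y}" for v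
  proof -
    have uT: "u = sqrt (- lie_prod u u) *\<^sub>R T1" and wT: "w = sqrt (- lie_prod w w) *\<^sub>R T2"
      using uu ww by (simp_all add: T1_def T2_def)
    have "fst (snd (B u)) = 0" "fst (snd (B w)) = 0"
      by (subst uT, simp add: linear_scale[OF lin] B(4))
         (subst wT, simp add: linear_scale[OF lin] B(5))
    moreover have "y = w + k *\<^sub>R u" "x = u - t *\<^sub>R y" by (simp_all add: w_def u_def)
    ultimately have "fst (snd (B y)) = 0" "fst (snd (B x)) = 0"
      by (metis (no_types) add.right_neutral fst_add snd_add fst_scaleR snd_scaleR lin linear_add
          linear_scale scaleR_zero_right,
          metis (no_types) \<open>y = w + k *\<^sub>R u\<close> add.right_neutral diff_self fst_add fst_diff snd_add snd_diff
          fst_scaleR snd_scaleR lin linear_add linear_diff linear_scale scaleR_zero_right)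
    moreover obtain p q where "v = p *\<^sub>R x + q *\<^sub>R y" using v mem_span_pair by metis
    ultimately show ?thesis by (simp add: linear_add[OF lin] linear_scale[OF lin])
  qed
  show thesis
  proof (rule that[OF B(1), of "\<lambda>i. fst (B (P i))" "\<lambda>i. snd (snd (B (P i)))"])
    fix i assume i: "i \<in> I"
    have eq: "B (P i) = (fst (B (P i)), 0, snd (snd (B (P i))))"
      using mid[OF P[OF i]] by (cases "B (P i)") simp
    \<comment> \<open>The pairing with T1, a multiple of u, becomes after B the pairing with
      (\<epsilon>, 0, 0), that is, the first coordinate of B (P i) up to sign.\<close>
    have "lie_prod (P i) T1 \<noteq> 0" using Pu[OF i] uu by (simp add: T1_def lie_prod_bilinear)
    then have "lie_prod (B (P i)) (\<epsilon>, 0, 0) \<noteq> 0" using B_prod[of "P i" T1] B(4) by simp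
    then have "fst (B (P i)) \<noteq> 0" by (subst (asm) eq) simp
    with eq show "B (P i) = (fst (B (P i)), 0, snd (snd (B (P i)))) \<and> fst (B (P i)) \<noteq> 0" by blast
  qed
qed

section \<open>Legendre frames and curvature spheres\<close>

text \<open>The part of \<open>curvature_spheres\<close> contributed by a single frame. Frame
  independence then becomes an equality between such sets.\<close>

definition frame_spheres ::
    "('p, 'm::finite) chart set \<Rightarrow> ('p \<Rightarrow> 'k::finite lvec) \<Rightarrow> ('p \<Rightarrow> 'k lvec) \<Rightarrow> 'p \<Rightarrow> 'k lvec set set"
  where
  "frame_spheres A Z W x =
     {proj (r *\<^sub>R Z x + s *\<^sub>R W x) | r s.
        (r \<noteq> 0 \<or> s \<noteq> 0) \<and>
        (\<exists>X. X \<noteq> 0 \<and>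
           r *\<^sub>R differential A Z x X + s *\<^sub>R differential A W x X \<in> span {Z x, W x})}"

text \<open>What the span condition amounts to for the frame (1, f, 0), (0, \<xi>, 1): the
  differentiated combination is (0, r df X + s d\<xi> X, 0), and the only vector of the span with
  both outer coordinates zero is 0.\<close>

definition contact_spheres ::
    "('p, 'm::finite) chart set \<Rightarrow> ('p \<Rightarrow> real ^ 'k::finite) \<Rightarrow> ('p \<Rightarrow> real ^ 'k) \<Rightarrow> 'p \<Rightarrow>
     'k lvec set set"
  where
  "contact_spheres A f \<xi> x =
     {proj (r *\<^sub>R (1, f x, 0) + s *\<^sub>R (0, \<xi> x, 1)) | r s.
        (r \<noteq> 0 \<or> s \<noteq> 0) \<and>
        (\<exists>X. X \<noteq> 0 \<and> r *\<^sub>R differential A f x X + s *\<^sub>R differential A \<xi> x X = 0)}"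

lemma mem_span_contact:
  "z \<in> span {(1, p, 0), (0, q, 1)} \<longleftrightarrow> z = fst z *\<^sub>R (1, p, 0) + snd (snd z) *\<^sub>R (0, q, 1)"
  unfolding mem_span_pair by (cases z) auto

lemma mem_span_contact_mid:
  "z \<in> span {(1, p, 0), (0, q, 1)} \<longleftrightarrow> fst (snd z) = fst z *\<^sub>R p + snd (snd z) *\<^sub>R q"
  unfolding mem_span_contact by (cases z) simp

lemma bounded_linear_components:
  "bounded_linear (\<lambda>z :: 'k::finite lvec. fst z)"
  "bounded_linear (\<lambda>z :: 'k::finite lvec. fst (snd z))"
  "bounded_linear (\<lambda>z :: 'k::finite lvec. snd (snd z))"
  by (auto intro: bounded_linear_fst bounded_linear_fst_comp bounded_linear_snd bounded_linear_snd_comp)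

context manifold
begin

text \<open>The outer coordinates of Z are its coefficients in the contact frame, so the product
  rule splits dZ. The first bracket is what the middle component would be if dZ lay in the span; the
  second one is the obstruction.\<close>

lemma differential_contact_span:
  fixes Z :: "'p \<Rightarrow> 'k::finite lvec"
  assumes smooth: "smooth_map A Z" "smooth_map A f" "smooth_map A \<xi>"
    and span: "\<And>p. p \<in> topspace M \<Longrightarrow> Z p \<in> span {(1, f p, 0), (0, \<xi> p, 1)}"
    and x: "x \<in> topspace M"
  shows "fst (snd (differential A Z x X)) =
     (fst (differential A Z x X) *\<^sub>R f x + snd (snd (differential A Z x X)) *\<^sub>R \<xi> x) +
     (fst (Z x) *\<^sub>R differential A f x X + snd (snd (Z x)) *\<^sub>R differential A \<xi> x X)"
proof -
  note sm = smooth_map_bounded_linear[OF bounded_linear_components(1) smooth(1)]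
    smooth_map_bounded_linear[OF bounded_linear_components(2) smooth(1)]
    smooth_map_bounded_linear[OF bounded_linear_components(3) smooth(1)]
  note D = differential_bounded_linear[OF x bounded_linear_components(1) smooth(1)]
    differential_bounded_linear[OF x bounded_linear_components(2) smooth(1)]
    differential_bounded_linear[OF x bounded_linear_components(3) smooth(1)]
  have "differential A (\<lambda>p. fst (Z p) *\<^sub>R f p + snd (snd (Z p)) *\<^sub>R \<xi> p) x =
      differential A (\<lambda>p. fst (snd (Z p))) x"
    using span by (intro differential_cong x sm) (simp add: mem_span_contact_mid)
  then have "fst (snd (differential A Z x X)) =
      differential A (\<lambda>p. fst (Z p) *\<^sub>R f p + snd (snd (Z p)) *\<^sub>R \<xi> p) x X"
    by (simp add: D)
  then show ?thesis
    using smooth sm by (simp add: differential_add differential_scaleR smooth_map_scaleR x D)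
qed

text \<open>Derivatives of the coefficients of a frame change only contribute vectors of the span,
  so the curvature condition transforms linearly. \<open>?R\<close> and \<open>?S\<close> are the
  coordinates of r Z + s W in the contact frame, and passing to them is an invertible linear
  substitution.\<close>

lemma frame_spheres_eq_contact_spheres:
  fixes Z W :: "'p \<Rightarrow> 'k::finite lvec"
  assumes smooth: "smooth_map A Z" "smooth_map A W" "smooth_map A f" "smooth_map A \<xi>"
    and span: "\<And>p. p \<in> topspace M \<Longrightarrow> span {Z p, W p} = span {(1, f p, 0), (0, \<xi> p, 1)}"
    and indep: "lin_indep2 (Z x) (W x)"
    and x: "x \<in> topspace M"
  shows "frame_spheres A Z W x = contact_spheres A f \<xi> x"
proof -
  have ZW: "Z p \<in> span {(1, f p, 0), (0, \<xi> p, 1)}" "W p \<in> span {(1, f p, 0), (0, \<xi> p, 1)}"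
    if "p \<in> topspace M" for p
    using span_base[of _ "{Z p, W p}"] span[OF that] by auto
  let ?R = "\<lambda>r s. r * fst (Z x) + s * fst (W x)"
  let ?S = "\<lambda>r s. r * snd (snd (Z x)) + s * snd (snd (W x))"
  let ?N = "\<lambda>r s. r *\<^sub>R (1, f x, 0) + s *\<^sub>R (0, \<xi> x, 1)"
  have comb: "r *\<^sub>R Z x + s *\<^sub>R W x = ?N (?R r s) (?S r s)" for r s
  proof -
    have "r *\<^sub>R Z x + s *\<^sub>R W x \<in> span {Z x, W x}" using mem_span_pair by blast
    then show ?thesis
      unfolding span[OF x] mem_span_contact by (simp only: fst_add snd_add fst_scaleR snd_scaleR real_scaleR_def)
  qed
  have kernel: "r *\<^sub>R differential A Z x X + s *\<^sub>R differential A W x X \<in> span {Z x, W x} \<longleftrightarrow>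
      ?R r s *\<^sub>R differential A f x X + ?S r s *\<^sub>R differential A \<xi> x X = 0" for r s X
    unfolding span[OF x] mem_span_contact_mid
    using differential_contact_span[OF smooth(1,3,4) ZW(1) x, of X]
      differential_contact_span[OF smooth(2,3,4) ZW(2) x, of X]
    by (simp add: algebra_simps)
  have nonzero: "(?R r s \<noteq> 0 \<or> ?S r s \<noteq> 0) \<longleftrightarrow> (r \<noteq> 0 \<or> s \<noteq> 0)" for r s
  proof -
    have "?R r s = 0 \<and> ?S r s = 0 \<longleftrightarrow> r *\<^sub>R Z x + s *\<^sub>R W x = 0"
      unfolding comb by (auto simp: zero_prod_def)
    also have "\<dots> \<longleftrightarrow> r = 0 \<and> s = 0" using indep by (auto simp: lin_indep2_iff)
    finally show ?thesis by blast
  qed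
  have onto: "\<exists>r s. r' = ?R r s \<and> s' = ?S r s" for r' s'
  proof -
    have "?N r' s' \<in> span {Z x, W x}" unfolding span[OF x] mem_span_pair by blast
    then obtain r s where "?N r' s' = r *\<^sub>R Z x + s *\<^sub>R W x" using mem_span_pair by metis
    then have "r' = ?R r s \<and> s' = ?S r s" unfolding comb by simp
    then show ?thesis by blast
  qed
  have "frame_spheres A Z W x = {proj (?N (?R r s) (?S r s)) | r s. (?R r s \<noteq> 0 \<or> ?S r s \<noteq> 0) \<and>
      (\<exists>X. X \<noteq> 0 \<and> ?R r s *\<^sub>R differential A f x X + ?S r s *\<^sub>R differential A \<xi> x X = 0)}"
    unfolding frame_spheres_def kernel nonzero comb ..
  also have "\<dots> = contact_spheres A f \<xi> x"
    unfolding contact_spheres_def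
  proof (intro Collect_cong iffI; elim exE conjE)
    fix p r' s' X
    assume *: "p = proj (?N r' s')" "r' \<noteq> 0 \<or> s' \<noteq> 0" "X \<noteq> 0"
      "r' *\<^sub>R differential A f x X + s' *\<^sub>R differential A \<xi> x X = 0"
    obtain r s where "r' = ?R r s" "s' = ?S r s" using onto by metis
    with * show "\<exists>r s. p = proj (?N (?R r s) (?S r s)) \<and> (?R r s \<noteq> 0 \<or> ?S r s \<noteq> 0) \<and>
      (\<exists>X. X \<noteq> 0 \<and> ?R r s *\<^sub>R differential A f x X + ?S r s *\<^sub>R differential A \<xi> x X = 0)"
      by blast
  qed blast
  finally show ?thesis .
qed

text \<open>Smoothness of \<open>lam\<close> as a map into \<open>Lambda\<close> supplies one smooth
  pair f, \<xi>. Every frame has the contact spheres of this pair, so the union over all frames is a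
  union of equal sets.\<close>

lemma curvature_spheres_eq_frame_spheres:
  fixes lam :: "'p \<Rightarrow> 'k::finite lvec set set"
  assumes "legendre_submanifold M A lam" "legendre_frame M A lam Z W" "x \<in> topspace M"
  shows "curvature_spheres M A lam x = frame_spheres A Z W x"
proof -
  obtain \<sigma> where \<sigma>: "smooth_map A \<sigma>" "\<And>p. p \<in> topspace M \<Longrightarrow> lam p = contact_line (\<sigma> p)"
    using assms(1) by (auto simp: legendre_submanifold_def smooth_map_Lambda_def)
  define f \<xi> where "f p = fst (\<sigma> p)" and "\<xi> p = snd (\<sigma> p)" for p
  have smooth: "smooth_map A f" "smooth_map A \<xi>"
    unfolding f_def \<xi>_def using \<sigma>(1) bounded_linear_fst bounded_linear_snd smooth_map_bounded_linear
    by blast+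
  have lam: "lam p = proj_line_through (1, f p, 0) (0, \<xi> p, 1)" if "p \<in> topspace M" for p
    using \<sigma>(2)[OF that] by (simp add: contact_line_def f_def \<xi>_def split_beta)
  have frame: "frame_spheres A Z' W' x = contact_spheres A f \<xi> x" if fr: "legendre_frame M A lam Z' W'"
    for Z' W'
  proof (rule frame_spheres_eq_contact_spheres[OF _ _ smooth _ _ assms(3)])
    show "smooth_map A Z'" "smooth_map A W'" "lin_indep2 (Z' x) (W' x)"
      using fr assms(3) by (auto simp: legendre_frame_def)
    show "span {Z' p, W' p} = span {(1, f p, 0), (0, \<xi> p, 1)}" if "p \<in> topspace M" for p
    proof -
      have "proj_line_through (Z' p) (W' p) = proj_line_through (1, f p, 0) (0, \<xi> p, 1)"
        using fr that lam by (auto simp: legendre_frame_def)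
      then show ?thesis by (simp add: span_pair_eq_iff_proj_line)
    qed
  qed
  have "curvature_spheres M A lam x = \<Union>{frame_spheres A Z' W' x | Z' W'. legendre_frame M A lam Z' W'}"
    unfolding curvature_spheres_def frame_spheres_def by blast
  also have "\<dots> = frame_spheres A Z W x" using frame assms(2) by auto
  finally show ?thesis .
qed

lemma frame_spheres_image:
  fixes Z W :: "'p \<Rightarrow> 'k::finite lvec"
  assumes "linear B" "bij B" "smooth_map A Z" "smooth_map A W" "x \<in> topspace M"
  shows "frame_spheres A (\<lambda>p. B (Z p)) (\<lambda>p. B (W p)) x = image B ` frame_spheres A Z W x"
proof -
  have bl: "bounded_linear B" using assms(1) by (rule linear_conv_bounded_linear[THEN iffD1])
  have comb: "r *\<^sub>R B u + s *\<^sub>R B v = B (r *\<^sub>R u + s *\<^sub>R v)" for r s u v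
    by (simp add: linear_add[OF assms(1)] linear_scale[OF assms(1)])
  have mem: "B u \<in> B ` S \<longleftrightarrow> u \<in> S" for u S
    using assms(2) by (simp add: bij_is_inj inj_image_mem_iff)
  have "frame_spheres A (\<lambda>p. B (Z p)) (\<lambda>p. B (W p)) x = {B ` proj (r *\<^sub>R Z x + s *\<^sub>R W x) | r s.
      (r \<noteq> 0 \<or> s \<noteq> 0) \<and>
      (\<exists>X. X \<noteq> 0 \<and> r *\<^sub>R differential A Z x X + s *\<^sub>R differential A W x X \<in> span {Z x, W x})}"
    unfolding frame_spheres_def
    by (simp only: differential_bounded_linear[OF assms(5) bl assms(3)]
        differential_bounded_linear[OF assms(5) bl assms(4)] comb
        image_span_pair[OF assms(1), symmetric] mem image_proj[OF assms(1)])
  also have "\<dots> = image B ` frame_spheres A Z W x"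
    unfolding frame_spheres_def by blast
  finally show ?thesis .
qed

section \<open>Principal curvatures and the curvature spheres of a Legendre lift\<close>

lemma principal_curvatures_iff:
  fixes f \<xi> :: "'p \<Rightarrow> real ^ 'k::finite"
  assumes hyp: "oriented_hypersurface M A f \<xi>" and card: "CARD('k) = CARD('m) + 2"
    and x: "x \<in> topspace M"
  shows "\<kappa> \<in> principal_curvatures A f \<xi> x \<longleftrightarrow>
     (\<exists>X. X \<noteq> 0 \<and> \<kappa> *\<^sub>R differential A f x X + differential A \<xi> x X = 0)"
proof -
  let ?df = "differential A f x" and ?d\<xi> = "differential A \<xi> x"
  have smooth: "smooth_map A f" "smooth_map A \<xi>"
    and pts: "\<And>p. p \<in> topspace M \<Longrightarrow> f p \<bullet> f p = 1" "\<And>p. p \<in> topspace M \<Longrightarrow> \<xi> p \<bullet> \<xi> p = 1"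
      "\<And>p. p \<in> topspace M \<Longrightarrow> f p \<bullet> \<xi> p = 0"
    and inj: "inj ?df" and df_\<xi>: "\<And>X. ?df X \<bullet> \<xi> x = 0"
    using hyp x by (auto simp: oriented_hypersurface_def norm_eq_1)
  note lin = linear_differential[OF x smooth(1)] linear_differential[OF x smooth(2)]
  have df_f: "?df X \<bullet> f x = 0" for X
    using differential_inner_const[OF x smooth(1) smooth(1) pts(1), of X] by (simp add: inner_commute)
  have d\<xi>_\<xi>: "?d\<xi> X \<bullet> \<xi> x = 0" for X
    using differential_inner_const[OF x smooth(2) smooth(2) pts(2), of X] by (simp add: inner_commute)
  have d\<xi>_f: "?d\<xi> X \<bullet> f x = 0" for X
    using differential_inner_const[OF x smooth(1) smooth(2) pts(3), of X] df_\<xi>[of X]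
    by (simp add: inner_commute)
  \<comment> \<open>The orthogonal complement of the plane of f x and \<xi> x has dimension
    \<open>CARD('k) - 2\<close>, the rank of the injective df. So df maps onto V, which also
    contains the values of d\<xi>; hence df Y = - d\<xi> X can be solved and the shape operator
    exists.\<close>
  define V where "V = {y. \<forall>z \<in> span {f x, \<xi> x}. orthogonal z y}"
  have memV: "y \<in> V \<longleftrightarrow> y \<bullet> f x = 0 \<and> y \<bullet> \<xi> x = 0" for y
  proof
    assume "y \<in> V"
    then show "y \<bullet> f x = 0 \<and> y \<bullet> \<xi> x = 0"
      using span_base[of _ "{f x, \<xi> x}"] by (auto simp: V_def orthogonal_def inner_commute)
  qed (auto simp: V_def mem_span_pair orthogonal_def inner_commute inner_add_right)
  have "independent {f x, \<xi> x}"
  proof (rule pairwise_orthogonal_independent)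
    show "pairwise orthogonal {f x, \<xi> x}"
      using pts(3)[OF x] by (auto simp: pairwise_def orthogonal_def inner_commute)
    show "0 \<notin> {f x, \<xi> x}" using pts[OF x] by auto
  qed
  moreover have "f x \<noteq> \<xi> x" using pts[OF x] by auto
  ultimately have "dim (span {f x, \<xi> x}) = 2" by (simp add: dim_eq_card_independent)
  then have "dim V = CARD('m)"
    using dim_subspace_orthogonal_to_vectors[of "span {f x, \<xi> x}" UNIV] card by (simp add: V_def)
  moreover have "dim (range ?df) = CARD('m)"
    using dim_image_eq[OF lin(1), of UNIV] inj by simp
  moreover have "range ?df \<subseteq> V" using df_f df_\<xi> memV by auto
  moreover have "subspace V" by (auto simp: subspace_def memV inner_add_left)
  moreover have "subspace (range ?df)" using lin(1) by (simp add: linear_subspace_image)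
  ultimately have range: "range ?df = V" by (intro subspace_dim_equal) auto
  have "\<exists>Y. ?df Y = - ?d\<xi> X" for X
  proof -
    have "- ?d\<xi> X \<in> V" using d\<xi>_f d\<xi>_\<xi> by (simp add: memV)
    then show ?thesis using range by (metis imageE)
  qed
  then obtain S where S: "\<And>X. ?df (S X) = - ?d\<xi> X" by metis
  have "shape_operator A f \<xi> x = S"
    unfolding shape_operator_def
  proof (rule the_equality)
    fix S' assume S': "\<forall>X. ?df (S' X) = - ?d\<xi> X"
    show "S' = S"
    proof
      fix X
      have "?df (S' X) = ?df (S X)" using S S' by simp
      then show "S' X = S X" using inj by (rule injD[rotated])
    qed
  qed (use S in simp)
  then have pc: "\<kappa> \<in> principal_curvatures A f \<xi> x \<longleftrightarrow> (\<exists>X. X \<noteq> 0 \<and> S X = \<kappa> *\<^sub>R X)"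
    by (simp add: principal_curvatures_def)
  have "S X = \<kappa> *\<^sub>R X \<longleftrightarrow> \<kappa> *\<^sub>R ?df X + ?d\<xi> X = 0" for X
  proof -
    have "S X = \<kappa> *\<^sub>R X \<longleftrightarrow> ?df (S X) = ?df (\<kappa> *\<^sub>R X)" using inj by (simp add: inj_eq)
    also have "\<dots> \<longleftrightarrow> \<kappa> *\<^sub>R ?df X + ?d\<xi> X = 0"
      unfolding S linear_scale[OF lin(1)] by (metis add.commute neg_eq_iff_add_eq_0)
    finally show ?thesis .
  qed
  then show ?thesis unfolding pc by simp
qed

text \<open>A solution with s = 0 would put X in the kernel of df, so an immersion allows the
  normalisation s = 1. With last coordinate 1, different \<kappa> give different points.\<close>

lemma contact_spheres_principal_curvatures:
  fixes f \<xi> :: "'p \<Rightarrow> real ^ 'k::finite"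
  assumes hyp: "oriented_hypersurface M A f \<xi>" and card: "CARD('k) = CARD('m) + 2"
    and x: "x \<in> topspace M"
  shows "bij_betw (\<lambda>\<kappa>. proj (\<kappa> *\<^sub>R (1, f x, 0) + (0, \<xi> x, 1)))
     (principal_curvatures A f \<xi> x) (contact_spheres A f \<xi> x)"
proof (rule bij_betw_imageI)
  let ?N = "\<lambda>\<kappa>. \<kappa> *\<^sub>R (1, f x, 0) + (0, \<xi> x, 1) :: 'k lvec"
  show "inj_on (\<lambda>\<kappa>. proj (?N \<kappa>)) (principal_curvatures A f \<xi> x)"
  proof (rule inj_onI)
    fix \<kappa> \<kappa>' assume eq: "proj (?N \<kappa>) = proj (?N \<kappa>')"
    obtain k where "?N \<kappa> = k *\<^sub>R ?N \<kappa>'" using proj_eqD[OF eq] ..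
    then show "\<kappa> = \<kappa>'" by simp
  qed
  have lin: "linear (differential A f x)" and inj: "inj (differential A f x)"
    using hyp x linear_differential by (auto simp: oriented_hypersurface_def)
  show "(\<lambda>\<kappa>. proj (?N \<kappa>)) ` principal_curvatures A f \<xi> x = contact_spheres A f \<xi> x"
  proof (intro equalityI subsetI)
    fix p assume "p \<in> (\<lambda>\<kappa>. proj (?N \<kappa>)) ` principal_curvatures A f \<xi> x"
    then obtain \<kappa> X where "p = proj (\<kappa> *\<^sub>R (1, f x, 0) + 1 *\<^sub>R (0, \<xi> x, 1))" "X \<noteq> 0"
      "\<kappa> *\<^sub>R differential A f x X + 1 *\<^sub>R differential A \<xi> x X = 0"
      using principal_curvatures_iff[OF assms] by auto
    then show "p \<in> contact_spheres A f \<xi> x"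
      unfolding contact_spheres_def mem_Collect_eq by (metis zero_neq_one)
  next
    fix p assume "p \<in> contact_spheres A f \<xi> x"
    then obtain r s X where p: "p = proj (r *\<^sub>R (1, f x, 0) + s *\<^sub>R (0, \<xi> x, 1))"
      "r \<noteq> 0 \<or> s \<noteq> 0" "X \<noteq> 0" "r *\<^sub>R differential A f x X + s *\<^sub>R differential A \<xi> x X = 0"
      unfolding contact_spheres_def by blast
    have "s \<noteq> 0"
    proof
      assume "s = 0"
      then have "differential A f x X = 0" using p by simp
      then show False using inj lin p(3) by (simp add: linear_injective_0)
    qed
    have "(r / s) *\<^sub>R differential A f x X + differential A \<xi> x X =
        (1 / s) *\<^sub>R (r *\<^sub>R differential A f x X + s *\<^sub>R differential A \<xi> x X)"
      using \<open>s \<noteq> 0\<close> by (simp add: scaleR_add_right)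
    then have "r / s \<in> principal_curvatures A f \<xi> x"
      using p principal_curvatures_iff[OF assms] by auto
    moreover have "r *\<^sub>R (1, f x, 0) + s *\<^sub>R (0, \<xi> x, 1) = s *\<^sub>R ?N (r / s)"
      using \<open>s \<noteq> 0\<close> by (simp add: scaleR_add_right)
    then have "p = proj (?N (r / s))" using p(1) \<open>s \<noteq> 0\<close> proj_scaleR by metis
    ultimately show "p \<in> (\<lambda>\<kappa>. proj (?N \<kappa>)) ` principal_curvatures A f \<xi> x" by blast
  qed
qed

text \<open>Solving for the vectors of the line with first and last coordinates \<open>(1, 0)\<close> and
  \<open>(0, 1)\<close>. The determinant does not vanish, since an isotropic vector \<open>(0, v, 0)\<close> is zero.\<close>

lemma contact_normal_form:
  fixes Z W :: "'p \<Rightarrow> 'k::finite lvec"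
  assumes smooth: "smooth_map A Z" "smooth_map A W"
    and indep: "\<And>p. p \<in> topspace M \<Longrightarrow> lin_indep2 (Z p) (W p)"
    and null: "\<And>p. p \<in> topspace M \<Longrightarrow> lie_prod (Z p) (Z p) = 0"
      "\<And>p. p \<in> topspace M \<Longrightarrow> lie_prod (W p) (W p) = 0"
      "\<And>p. p \<in> topspace M \<Longrightarrow> lie_prod (Z p) (W p) = 0"
    and contact: "\<And>p X. p \<in> topspace M \<Longrightarrow> lie_prod (differential A Z p X) (W p) = 0"
  obtains f \<xi> :: "'p \<Rightarrow> real ^ 'k" where "smooth_map A f" "smooth_map A \<xi>"
    "\<And>p. p \<in> topspace M \<Longrightarrow> span {Z p, W p} = span {(1, f p, 0), (0, \<xi> p, 1)}"
    "\<And>p. p \<in> topspace M \<Longrightarrow> norm (f p) = 1 \<and> norm (\<xi> p) = 1 \<and> f p \<bullet> \<xi> p = 0"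
    "\<And>p X. p \<in> topspace M \<Longrightarrow> differential A f p X \<bullet> \<xi> p = 0"
proof -
  define a b c d where "a p = fst (Z p)" and "b p = snd (snd (Z p))"
    and "c p = fst (W p)" and "d p = snd (snd (W p))" for p
  \<comment> \<open>The determinant of the outer coordinates of Z and W; f and \<xi> below come from
    Cramer's rule, which keeps them smooth where \<Delta> is nonzero.\<close>
  define \<Delta> where "\<Delta> p = a p *\<^sub>R d p - b p *\<^sub>R c p" for p
  define f where "f p =
    (inverse (\<Delta> p) *\<^sub>R d p) *\<^sub>R fst (snd (Z p)) - (inverse (\<Delta> p) *\<^sub>R b p) *\<^sub>R fst (snd (W p))" for p
  define \<xi> where "\<xi> p =
    (inverse (\<Delta> p) *\<^sub>R a p) *\<^sub>R fst (snd (W p)) - (inverse (\<Delta> p) *\<^sub>R c p) *\<^sub>R fst (snd (Z p))" for p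
  have comb_null: "lie_prod (r *\<^sub>R Z p + s *\<^sub>R W p) (r' *\<^sub>R Z p + s' *\<^sub>R W p) = 0"
    if "p \<in> topspace M" for p r s r' s'
    using null[OF that] lie_prod_commute[of "W p" "Z p"] by (simp add: lie_prod_bilinear)
  have \<Delta>_nz: "\<Delta> p \<noteq> 0" if p: "p \<in> topspace M" for p
  proof
    assume \<Delta>: "\<Delta> p = 0"
    have zero: "r = 0 \<and> s = 0" if rs: "r * a p + s * c p = 0" "r * b p + s * d p = 0" for r s
    proof -
      obtain v where v: "r *\<^sub>R Z p + s *\<^sub>R W p = (0, v, 0)"
        using rs by (cases "Z p"; cases "W p") (auto simp: a_def b_def c_def d_def)
      then have "lie_prod (0, v, 0) (0, v, 0) = 0" using comb_null[OF p, of r s r s] by simp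
      then have "v = 0" by simp
      then have "r *\<^sub>R Z p + s *\<^sub>R W p = 0" using v by (simp add: zero_prod_def)
      then show ?thesis using indep[OF p] unfolding lin_indep2_iff by blast
    qed
    \<comment> \<open>If \<Delta> = 0, the coefficient pairs (d, -b) and (-c, a) solve the
      homogeneous system, so all four entries vanish. Then (1, 0) is a solution too, which is
      absurd.\<close>
    have "d p = 0 \<and> - b p = 0" using \<Delta> by (intro zero) (simp_all add: \<Delta>_def algebra_simps)
    moreover have "- c p = 0 \<and> a p = 0" using \<Delta> by (intro zero) (simp_all add: \<Delta>_def algebra_simps)
    ultimately have "(1 :: real) = 0 \<and> (0 :: real) = 0" by (intro zero) simp_all
    then show False by simp
  qed
  have sm: "smooth_map A a" "smooth_map A b" "smooth_map A c" "smooth_map A d"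
    "smooth_map A (\<lambda>p. fst (snd (Z p)))" "smooth_map A (\<lambda>p. fst (snd (W p)))"
    unfolding a_def b_def c_def d_def
    using smooth_map_bounded_linear[OF bounded_linear_components(1)]
      smooth_map_bounded_linear[OF bounded_linear_components(2)]
      smooth_map_bounded_linear[OF bounded_linear_components(3)] smooth by blast+
  have "smooth_map A \<Delta>"
    unfolding \<Delta>_def by (intro smooth_map_diff smooth_map_scaleR sm)
  then have inv: "smooth_map A (\<lambda>p. inverse (\<Delta> p))" using \<Delta>_nz by (rule smooth_map_inverse)
  have smooth_f: "smooth_map A f" and smooth_\<xi>: "smooth_map A \<xi>"
    unfolding f_def \<xi>_def by (intro smooth_map_diff smooth_map_scaleR inv sm)+
  have Zn: "(1, f p, 0) = (d p / \<Delta> p) *\<^sub>R Z p + (- b p / \<Delta> p) *\<^sub>R W p"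
    and Wn: "(0, \<xi> p, 1) = (- c p / \<Delta> p) *\<^sub>R Z p + (a p / \<Delta> p) *\<^sub>R W p" if p: "p \<in> topspace M" for p
  proof -
    have "d p * a p - b p * c p = \<Delta> p" by (simp add: \<Delta>_def)
    then have "(d p * a p - b p * c p) / \<Delta> p = 1" using \<Delta>_nz[OF p] by simp
    then have D: "d p * a p / \<Delta> p - b p * c p / \<Delta> p = 1" by (simp add: diff_divide_distrib)
    obtain v where Z: "Z p = (a p, v, b p)" by (cases "Z p") (simp add: a_def b_def)
    obtain w where W: "W p = (c p, w, d p)" by (cases "W p") (simp add: c_def d_def)
    show "(1, f p, 0) = (d p / \<Delta> p) *\<^sub>R Z p + (- b p / \<Delta> p) *\<^sub>R W p"
      unfolding f_def Z W using D by (simp add: divide_inverse mult_ac)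
    show "(0, \<xi> p, 1) = (- c p / \<Delta> p) *\<^sub>R Z p + (a p / \<Delta> p) *\<^sub>R W p"
      unfolding \<xi>_def Z W using D by (simp add: divide_inverse mult_ac)
  qed
  have Z_eq: "Z p = a p *\<^sub>R (1, f p, 0) + b p *\<^sub>R (0, \<xi> p, 1)"
    and W_eq: "W p = c p *\<^sub>R (1, f p, 0) + d p *\<^sub>R (0, \<xi> p, 1)" if p: "p \<in> topspace M" for p
  proof -
    have "\<Delta> p *\<^sub>R (1, f p, 0) = d p *\<^sub>R Z p - b p *\<^sub>R W p"
      "\<Delta> p *\<^sub>R (0, \<xi> p, 1) = a p *\<^sub>R W p - c p *\<^sub>R Z p"
      unfolding Zn[OF p] Wn[OF p] using \<Delta>_nz[OF p] by (simp_all add: scaleR_diff_right)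
    moreover have "a p *\<^sub>R (d p *\<^sub>R Z p - b p *\<^sub>R W p) + b p *\<^sub>R (a p *\<^sub>R W p - c p *\<^sub>R Z p) = \<Delta> p *\<^sub>R Z p"
      "c p *\<^sub>R (d p *\<^sub>R Z p - b p *\<^sub>R W p) + d p *\<^sub>R (a p *\<^sub>R W p - c p *\<^sub>R Z p) = \<Delta> p *\<^sub>R W p"
      by (simp_all add: \<Delta>_def algebra_simps)
    ultimately have "a p *\<^sub>R (\<Delta> p *\<^sub>R (1, f p, 0)) + b p *\<^sub>R (\<Delta> p *\<^sub>R (0, \<xi> p, 1)) = \<Delta> p *\<^sub>R Z p"
      "c p *\<^sub>R (\<Delta> p *\<^sub>R (1, f p, 0)) + d p *\<^sub>R (\<Delta> p *\<^sub>R (0, \<xi> p, 1)) = \<Delta> p *\<^sub>R W p"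
      by (simp_all only:)
    then have "\<Delta> p *\<^sub>R (a p *\<^sub>R (1, f p, 0) + b p *\<^sub>R (0, \<xi> p, 1)) = \<Delta> p *\<^sub>R Z p"
      "\<Delta> p *\<^sub>R (c p *\<^sub>R (1, f p, 0) + d p *\<^sub>R (0, \<xi> p, 1)) = \<Delta> p *\<^sub>R W p"
      by (simp_all only: scaleR_add_right scaleR_left_commute)
    then show "Z p = a p *\<^sub>R (1, f p, 0) + b p *\<^sub>R (0, \<xi> p, 1)"
      "W p = c p *\<^sub>R (1, f p, 0) + d p *\<^sub>R (0, \<xi> p, 1)"
      using \<Delta>_nz[OF p] by (metis scaleR_left_imp_eq)+
  qed
  have span: "span {Z p, W p} = span {(1, f p, 0), (0, \<xi> p, 1)}" if p: "p \<in> topspace M" for p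
  proof -
    have "{Z p, W p} \<subseteq> span {(1, f p, 0), (0, \<xi> p, 1)}"
      using Z_eq[OF p] W_eq[OF p] mem_span_pair by blast
    moreover have "{(1, f p, 0), (0, \<xi> p, 1)} \<subseteq> span {Z p, W p}"
      using Zn[OF p] Wn[OF p] mem_span_pair by blast
    ultimately show ?thesis by (intro equalityI span_minimal) auto
  qed
  have unit: "f p \<bullet> f p = 1" "\<xi> p \<bullet> \<xi> p = 1" "f p \<bullet> \<xi> p = 0" if p: "p \<in> topspace M" for p
  proof -
    have "lie_prod (1, f p, 0) (1, f p, 0) = 0" "lie_prod (0, \<xi> p, 1) (0, \<xi> p, 1) = 0"
      "lie_prod (1, f p, 0) (0, \<xi> p, 1) = 0"
      unfolding Zn[OF p] Wn[OF p] by (rule comb_null[OF p])+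
    then show "f p \<bullet> f p = 1" "\<xi> p \<bullet> \<xi> p = 1" "f p \<bullet> \<xi> p = 0" by simp_all
  qed
  have contact_f: "differential A f p X \<bullet> \<xi> p = 0" if p: "p \<in> topspace M" for p X
  proof -
    let ?df = "differential A f p X" and ?d\<xi> = "differential A \<xi> p X"
    have orth: "?df \<bullet> f p = 0" "?d\<xi> \<bullet> \<xi> p = 0" "?d\<xi> \<bullet> f p = - (?df \<bullet> \<xi> p)"
      using differential_inner_const[OF p smooth_f smooth_f unit(1), of X]
        differential_inner_const[OF p smooth_\<xi> smooth_\<xi> unit(2), of X]
        differential_inner_const[OF p smooth_f smooth_\<xi> unit(3), of X]
      by (simp_all add: inner_commute)
    have "Z q \<in> span {(1, f q, 0), (0, \<xi> q, 1)}" if "q \<in> topspace M" for q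
      using Z_eq[OF that] mem_span_pair by blast
    note dZ = differential_contact_span[OF smooth(1) smooth_f smooth_\<xi> this p, of X]
    have dZ_eq: "differential A Z p X =
        (fst (differential A Z p X) *\<^sub>R (1, f p, 0) + snd (snd (differential A Z p X)) *\<^sub>R (0, \<xi> p, 1)) +
        (0, a p *\<^sub>R ?df + b p *\<^sub>R ?d\<xi>, 0)"
      using dZ by (cases "differential A Z p X") (simp add: a_def b_def)
    have "0 = lie_prod (differential A Z p X) (c p *\<^sub>R (1, f p, 0) + d p *\<^sub>R (0, \<xi> p, 1))"
      using contact[OF p] W_eq[OF p] by simp
    \<comment> \<open>The span part of dZ is orthogonal to W. Pairing a df + b d\<xi> with c f + d
      \<xi> leaves a d (df \<bullet> \<xi>) + b c (d\<xi> \<bullet> f), and d\<xi> \<bullet> f = -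
      df \<bullet> \<xi>.\<close>
    also have "\<dots> = \<Delta> p * (?df \<bullet> \<xi> p)"
      using unit[OF p] orth
      by (subst dZ_eq) (simp add: \<Delta>_def algebra_simps inner_commute[of "\<xi> p" "f p"])
    finally show ?thesis using \<Delta>_nz[OF p] by simp
  qed
  show thesis
    using that[OF smooth_f smooth_\<xi> span] unit contact_f by (simp add: norm_eq_1)
qed

end

lemma lie_similarity_lin_indep2:
  assumes "lie_similarity c B" "lin_indep2 x y"
  shows "lin_indep2 (B x) (B y)"
  unfolding lin_indep2_iff
proof (intro allI impI)
  fix a b assume "a *\<^sub>R B x + b *\<^sub>R B y = 0"
  moreover have lin: "linear B" and "inj B"
    using assms(1) by (auto simp: lie_similarity_def bij_is_inj)
  ultimately have "B (a *\<^sub>R x + b *\<^sub>R y) = B 0"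
    by (simp add: linear_add linear_scale linear_0)
  then have "a *\<^sub>R x + b *\<^sub>R y = 0" using \<open>inj B\<close> by (rule injD[rotated])
  then show "a = 0 \<and> b = 0" using assms(2) unfolding lin_indep2_iff by blast
qed

section \<open>The two implications of the equivalence\<close>

context manifold
begin

text \<open>The enumeration \<open>e\<close> of the principal curvatures is chosen at one base point
  and stays valid everywhere by constancy, so \<open>P i\<close> does not depend on x. The inverse
  \<open>C\<close> carries points and spheres back from the lift to \<open>lam\<close>; it scales
  the product by 1/c > 0, which preserves orthogonality and timelike vectors.\<close>

lemma isoparametric_imp_orthogonal_points:
  fixes lam :: "'p \<Rightarrow> 'k::finite lvec set set"
  assumes card: "CARD('k) = CARD('m) + 2"
    and legendre: "legendre_submanifold M A lam"
    and g: "\<And>x. x \<in> topspace M \<Longrightarrow>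
      finite (curvature_spheres M A lam x) \<and> card (curvature_spheres M A lam x) = g"
    and iso: "isoparametric M A f \<xi>" "lie_equivalent M lam (legendre_lift f \<xi>)"
  shows "\<exists>(P :: nat \<Rightarrow> 'k lvec) L.
     timelike_line L \<and> (\<forall>i\<in>{1..g}. P i \<noteq> 0 \<and> proj (P i) \<in> L) \<and>
     (\<forall>x\<in>topspace M. \<exists>K :: nat \<Rightarrow> 'k lvec.
        bij_betw (\<lambda>i. proj (K i)) {1..g} (curvature_spheres M A lam x) \<and>
        (\<forall>i\<in>{1..g}. lie_prod (K i) (P i) = 0))"
proof -
  have hyp: "oriented_hypersurface M A f \<xi>" using iso(1) by (simp add: isoparametric_def)
  obtain \<beta> where \<beta>: "lie_sphere_transformation \<beta>"
    "\<And>x. x \<in> topspace M \<Longrightarrow> legendre_lift f \<xi> x = \<beta> ` lam x"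
    using iso(2) by (auto simp: lie_equivalent_def)
  have "CARD('m) \<ge> 1" by (simp add: Suc_leI)
  then have "CARD('k) \<ge> 3" using card by simp
  then obtain c B where B: "lie_similarity c B" "\<And>x. x \<noteq> 0 \<Longrightarrow> \<beta> (proj x) = proj (B x)"
    using lie_sphere_transformation_similarity[OF \<beta>(1)] by metis
  have lin: "linear B" "bij B" and "c > 0" using B(1) by (auto simp: lie_similarity_def)
  define C where "C = inv B"
  have CB: "C (B x) = x" for x using lin(2) by (simp add: C_def bij_is_inj)
  have BC: "B (C x) = x" for x using lin(2) by (simp add: C_def bij_is_surj surj_f_inv_f)
  have lin_C: "linear C"
  proof (rule linearI)
    show "C (x + y) = C x + C y" for x y by (metis BC CB linear_add[OF lin(1)])
    show "C (r *\<^sub>R x) = r *\<^sub>R C x" for r x by (metis BC CB linear_scale[OF lin(1)])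
  qed
  have C_prod: "lie_prod (C x) (C y) = lie_prod x y / c" for x y
    unfolding C_def by (rule lie_similarity_inv[OF B(1)])
  obtain Z W where frame: "legendre_frame M A lam Z W"
    using legendre by (auto simp: legendre_submanifold_def)
  then have smooth: "smooth_map A Z" "smooth_map A W"
    and lam: "\<And>x. x \<in> topspace M \<Longrightarrow> lam x = proj_line_through (Z x) (W x)"
    and indep: "\<And>x. x \<in> topspace M \<Longrightarrow> lin_indep2 (Z x) (W x)"
    by (auto simp: legendre_frame_def)
  have span: "span {B (Z x), B (W x)} = span {(1, f x, 0), (0, \<xi> x, 1)}" if x: "x \<in> topspace M" for x
  proof -
    have "proj_line_through (B (Z x)) (B (W x)) = proj_line_through (1, f x, 0) (0, \<xi> x, 1)"
      using \<beta>(2)[OF x] image_proj_line[OF lin, of \<beta>] B(2) lam[OF x] by (simp add: legendre_lift_def)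
    then show ?thesis by (simp add: span_pair_eq_iff_proj_line)
  qed
  have bl: "bounded_linear B" using lin(1) by (rule linear_conv_bounded_linear[THEN iffD1])
  have spheres: "contact_spheres A f \<xi> x = image B ` curvature_spheres M A lam x"
    if x: "x \<in> topspace M" for x
  proof -
    have "contact_spheres A f \<xi> x = frame_spheres A (\<lambda>p. B (Z p)) (\<lambda>p. B (W p)) x"
      using hyp span lie_similarity_lin_indep2[OF B(1) indep[OF x]]
      by (intro frame_spheres_eq_contact_spheres[symmetric] smooth_map_bounded_linear[OF bl] smooth x)
         (auto simp: oriented_hypersurface_def)
    then show ?thesis
      using frame_spheres_image[OF lin smooth x] curvature_spheres_eq_frame_spheres[OF legendre frame x]
      by simp
  qed
  let ?pc = "principal_curvatures A f \<xi>"
  let ?N = "\<lambda>x \<kappa>. \<kappa> *\<^sub>R (1, f x, 0) + (0, \<xi> x, 1) :: 'k lvec"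
  have C_bij: "bij_betw (\<lambda>\<kappa>. proj (C (?N x \<kappa>))) (?pc x) (curvature_spheres M A lam x)"
    if x: "x \<in> topspace M" for x
  proof -
    have "bij_betw (image C) (contact_spheres A f \<xi> x) (curvature_spheres M A lam x)"
      unfolding spheres[OF x]
      by (intro bij_betwI[of _ _ _ "image B"]) (simp_all add: image_image CB BC Pi_iff)
    from bij_betw_trans[OF contact_spheres_principal_curvatures[OF hyp card x] this]
    show ?thesis by (simp add: comp_def image_proj[OF lin_C])
  qed
  obtain e where e: "\<And>x. x \<in> topspace M \<Longrightarrow> bij_betw e {1..g} (?pc x)"
  \<comment> \<open>On an empty manifold nothing ties g to principal curvatures, yet points
    \<open>P i\<close> still have to be produced; any \<open>e\<close> serves.\<close>
  proof (cases "topspace M = {}")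
    case False
    then obtain x0 where x0: "x0 \<in> topspace M" by blast
    have "finite (?pc x0)" "card (?pc x0) = g"
      using C_bij[OF x0] g[OF x0] bij_betw_finite bij_betw_same_card by metis+
    then obtain e where "bij_betw e {1..g} (?pc x0)"
      using ex_bij_betw_nat_finite_1 by blast
    moreover have "?pc x = ?pc x0" if "x \<in> topspace M" for x
      using iso(1) that x0 unfolding isoparametric_def by blast
    ultimately show thesis using that by simp
  qed (use that in auto)
  define P where "P i = C (1, 0, - e i)" for i
  define L where "L = proj_line_through (C (1, 0, 0)) (C (0, 0, 1))"
  have comb: "r *\<^sub>R C (1, 0, 0) + s *\<^sub>R C (0, 0, 1) = C (r, 0, s)" for r s
    by (simp add: linear_add[OF lin_C, symmetric] linear_scale[OF lin_C, symmetric])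
  have C_zero: "C x = 0 \<longleftrightarrow> x = 0" for x
    using lin CB lin_C by (metis C_def bij_inv_eq_iff linear_0)
  have "timelike_line L"
    unfolding timelike_line_def
  proof (intro conjI ballI)
    have "lin_indep2 (C (1, 0, 0)) (C (0, 0, 1))"
      unfolding lin_indep2_iff comb C_zero by (simp add: zero_prod_def)
    then show "is_proj_line L" unfolding is_proj_line_def L_def by blast
    fix p assume "p \<in> L"
    then obtain r s where rs: "p = proj (C (r, 0, s))" "C (r, 0, s) \<noteq> 0"
      unfolding L_def proj_line_through_def mem_span_pair comb by blast
    have "r \<noteq> 0 \<or> s \<noteq> 0" using rs(2) unfolding C_zero by (simp add: zero_prod_def)
    then have "lie_prod (r, 0, s) (r, 0, s) < (0 :: real)"
      using sum_squares_gt_zero_iff[of r s] by simp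
    then have "lie_prod (C (r, 0, s)) (C (r, 0, s)) < 0"
      unfolding C_prod using \<open>c > 0\<close> by (rule divide_neg_pos)
    then show "timelike_point p" using rs unfolding timelike_point_def by blast
  qed
  moreover have "P i \<noteq> 0 \<and> proj (P i) \<in> L" for i
  proof
    show "P i \<noteq> 0" unfolding P_def C_zero by (simp add: zero_prod_def)
    moreover have "P i \<in> span {C (1, 0, 0), C (0, 0, 1)}"
      unfolding mem_span_pair comb P_def by blast
    ultimately show "proj (P i) \<in> L" unfolding L_def by (simp add: proj_line_through_mem)
  qed
  moreover have "\<exists>K. bij_betw (\<lambda>i. proj (K i)) {1..g} (curvature_spheres M A lam x) \<and>
        (\<forall>i\<in>{1..g}. lie_prod (K i) (P i) = 0)" if x: "x \<in> topspace M" for x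
  proof (intro exI conjI ballI)
    show "bij_betw (\<lambda>i. proj (C (?N x (e i)))) {1..g} (curvature_spheres M A lam x)"
      using bij_betw_trans[OF e[OF x] C_bij[OF x]] by (simp add: comp_def)
    show "lie_prod (C (?N x (e i))) (P i) = 0" for i
      by (simp add: P_def C_prod)
  qed
  ultimately show ?thesis by blast
qed

text \<open>After a similarity adapted to the P i, the transformed frame in contact normal form
  supplies f and \<xi>. The values - b i / a i are read off from the fixed points alone, so they do
  not depend on x.\<close>

lemma orthogonal_points_imp_isoparametric:
  fixes lam :: "'p \<Rightarrow> 'k::finite lvec set set" and P :: "nat \<Rightarrow> 'k lvec"
  assumes card: "CARD('k) = CARD('m) + 2"
    and legendre: "legendre_submanifold M A lam"
    and L: "timelike_line L" and P: "\<And>i. i \<in> {1..g} \<Longrightarrow> P i \<noteq> 0 \<and> proj (P i) \<in> L"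
    and K: "\<And>x. x \<in> topspace M \<Longrightarrow> \<exists>K :: nat \<Rightarrow> 'k lvec.
        bij_betw (\<lambda>i. proj (K i)) {1..g} (curvature_spheres M A lam x) \<and>
        (\<forall>i\<in>{1..g}. lie_prod (K i) (P i) = 0)"
  shows "\<exists>(f :: 'p \<Rightarrow> real ^ 'k) \<xi>.
     isoparametric M A f \<xi> \<and> lie_equivalent M lam (legendre_lift f \<xi>)"
proof -
  obtain B a b where B: "lie_similarity 1 B"
    and BP: "\<And>i. i \<in> {1..g} \<Longrightarrow> B (P i) = (a i, 0, b i) \<and> a i \<noteq> 0"
    using timelike_line_normal_form[OF L, of "{1..g}" P] P by (metis finite_atLeastAtMost)
  have lin: "linear B" "bij B" and B_prod: "\<And>x y. lie_prod (B x) (B y) = lie_prod x y"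
    using B by (auto simp: lie_similarity_def)
  have bl: "bounded_linear B" using lin(1) by (rule linear_conv_bounded_linear[THEN iffD1])
  obtain Z W where frame: "legendre_frame M A lam Z W"
    using legendre by (auto simp: legendre_submanifold_def)
  then have smooth: "smooth_map A Z" "smooth_map A W"
    and lam: "\<And>x. x \<in> topspace M \<Longrightarrow> lam x = proj_line_through (Z x) (W x)"
    and indep: "\<And>x. x \<in> topspace M \<Longrightarrow> lin_indep2 (Z x) (W x)"
    and null: "\<And>x. x \<in> topspace M \<Longrightarrow> lie_prod (Z x) (Z x) = 0"
      "\<And>x. x \<in> topspace M \<Longrightarrow> lie_prod (W x) (W x) = 0"
      "\<And>x. x \<in> topspace M \<Longrightarrow> lie_prod (Z x) (W x) = 0"
    and contact: "\<And>x X. x \<in> topspace M \<Longrightarrow> lie_prod (differential A Z x X) (W x) = 0"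
    unfolding legendre_frame_def by blast+
  note smooth_B = smooth_map_bounded_linear[OF bl smooth(1)] smooth_map_bounded_linear[OF bl smooth(2)]
  note indep_B = lie_similarity_lin_indep2[OF B indep]
  obtain f \<xi> :: "'p \<Rightarrow> real ^ 'k" where smooth_f: "smooth_map A f" "smooth_map A \<xi>"
    and span: "\<And>x. x \<in> topspace M \<Longrightarrow> span {B (Z x), B (W x)} = span {(1, f x, 0), (0, \<xi> x, 1)}"
    and unit: "\<And>x. x \<in> topspace M \<Longrightarrow> norm (f x) = 1 \<and> norm (\<xi> x) = 1 \<and> f x \<bullet> \<xi> x = 0"
    and contact_f: "\<And>x X. x \<in> topspace M \<Longrightarrow> differential A f x X \<bullet> \<xi> x = 0"
    using contact_normal_form[OF smooth_B indep_B] null contact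
    by (simp add: B_prod differential_bounded_linear[OF _ bl smooth(1)]) metis
  have spheres: "contact_spheres A f \<xi> x = image B ` curvature_spheres M A lam x"
    if x: "x \<in> topspace M" for x
    using frame_spheres_eq_contact_spheres[OF smooth_B smooth_f span indep_B[OF x] x]
      frame_spheres_image[OF lin smooth x] curvature_spheres_eq_frame_spheres[OF legendre frame x]
    by simp
  \<comment> \<open>The labelling at x attaches some index i to the given sphere. The two
    representatives of the sphere differ by a scalar, which does not affect orthogonality to B (P
    i).\<close>
  have orth: "\<exists>i\<in>{1..g}. r * a i + s * b i = 0"
    if x: "x \<in> topspace M" and mem: "proj (r *\<^sub>R (1, f x, 0) + s *\<^sub>R (0, \<xi> x, 1)) \<in> contact_spheres A f \<xi> x"
    for x r s
  proof -
    obtain K where K: "bij_betw (\<lambda>i. proj (K i)) {1..g} (curvature_spheres M A lam x)"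
      "\<And>i. i \<in> {1..g} \<Longrightarrow> lie_prod (K i) (P i) = 0" using K[OF x] by metis
    obtain i where i: "i \<in> {1..g}" "proj (r *\<^sub>R (1, f x, 0) + s *\<^sub>R (0, \<xi> x, 1)) = B ` proj (K i)"
      using mem bij_betw_imp_surj_on[OF K(1), symmetric] unfolding spheres[OF x] by auto
    then obtain k where "r *\<^sub>R (1, f x, 0) + s *\<^sub>R (0, \<xi> x, 1) = k *\<^sub>R B (K i)"
      using proj_eqD image_proj[OF lin(1)] by metis
    then have "lie_prod (r *\<^sub>R (1, f x, 0) + s *\<^sub>R (0, \<xi> x, 1)) (B (P i)) = 0"
      using K(2)[OF i(1)] by (simp only: lie_prod_scaleR_left B_prod mult_zero_right)
    then have "r * a i + s * b i = 0" using BP[OF i(1)] by simp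
    then show ?thesis using i(1) by blast
  qed
  have "oriented_hypersurface M A f \<xi>"
    unfolding oriented_hypersurface_def
  proof (intro conjI ballI)
    fix x assume x: "x \<in> topspace M"
    have "X = 0" if "differential A f x X = 0" for X
    proof (rule ccontr)
      assume "X \<noteq> 0"
      \<comment> \<open>A kernel vector of df makes (1, f, 0) a curvature sphere, the case r = 1, s
        = 0. The relation then reads a i = 0, which the choice of B rules out.\<close>
      then have "proj (1 *\<^sub>R (1, f x, 0) + 0 *\<^sub>R (0, \<xi> x, 1)) \<in> contact_spheres A f \<xi> x"
        unfolding contact_spheres_def mem_Collect_eq
        by (intro exI[of _ 1] exI[of _ 0] conjI exI[of _ X]) (simp_all add: that)
      then show False using orth[OF x] BP by fastforce
    qed
    then show "inj (differential A f x)"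
      using linear_differential[OF x smooth_f(1)] by (simp add: linear_injective_0)
  qed (use smooth_f unit contact_f in auto)
  moreover have "principal_curvatures A f \<xi> x = (\<lambda>i. - b i / a i) ` {1..g}"
    if x: "x \<in> topspace M" and hyp: "oriented_hypersurface M A f \<xi>" for x
  proof (intro equalityI subsetI)
    note bij = contact_spheres_principal_curvatures[OF hyp card x]
    have solve: "\<kappa> = - b i / a i" if "\<kappa> * a i + b i = 0" "i \<in> {1..g}" for \<kappa> i
      using that BP[of i] by (simp add: field_simps eq_neg_iff_add_eq_0)
    {
      fix \<kappa> assume "\<kappa> \<in> principal_curvatures A f \<xi> x"
      then have "proj (\<kappa> *\<^sub>R (1, f x, 0) + 1 *\<^sub>R (0, \<xi> x, 1)) \<in> contact_spheres A f \<xi> x"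
        using bij_betwE[OF bij] by auto
      from orth[OF x this] obtain i where i: "i \<in> {1..g}" "\<kappa> * a i + b i = 0" by auto
      from solve[OF i(2,1)] i(1) show "\<kappa> \<in> (\<lambda>i. - b i / a i) ` {1..g}" by (rule image_eqI)
    }
    \<comment> \<open>Without this inclusion the set of principal curvatures could be a varying
      subset of the fixed values. The sphere labelled i exists at every x, and its principal
      curvature \<mu> satisfies the i-th relation, which has a single solution since a i is
      nonzero.\<close>
    fix \<kappa> assume "\<kappa> \<in> (\<lambda>i. - b i / a i) ` {1..g}"
    then obtain i where i: "i \<in> {1..g}" "\<kappa> = - b i / a i" by blast
    obtain K where K: "bij_betw (\<lambda>i. proj (K i)) {1..g} (curvature_spheres M A lam x)"
      "\<And>i. i \<in> {1..g} \<Longrightarrow> lie_prod (K i) (P i) = 0" using K[OF x] by metis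
    have "proj (K i) \<in> curvature_spheres M A lam x" using bij_betwE[OF K(1)] i(1) by simp
    then have "B ` proj (K i) \<in> contact_spheres A f \<xi> x" unfolding spheres[OF x] by (rule imageI)
    then obtain \<mu> where \<mu>: "\<mu> \<in> principal_curvatures A f \<xi> x"
      "proj (B (K i)) = proj (\<mu> *\<^sub>R (1, f x, 0) + (0, \<xi> x, 1))"
      using bij_betw_imp_surj_on[OF bij] image_proj[OF lin(1)] by (metis (no_types, lifting) imageE)
    obtain k where "\<mu> *\<^sub>R (1, f x, 0) + (0, \<xi> x, 1) = k *\<^sub>R B (K i)"
      using proj_eqD[OF \<mu>(2)[symmetric]] ..
    then have "lie_prod (\<mu> *\<^sub>R (1, f x, 0) + (0, \<xi> x, 1)) (B (P i)) = 0"
      using K(2)[OF i(1)] by (simp only: lie_prod_scaleR_left B_prod mult_zero_right)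
    then have "\<mu> = \<kappa>" using BP[OF i(1)] solve[of \<mu> i] i by simp
    then show "\<kappa> \<in> principal_curvatures A f \<xi> x" using \<mu> by simp
  qed
  ultimately have "isoparametric M A f \<xi>" by (simp add: isoparametric_def)
  moreover have "lie_equivalent M lam (legendre_lift f \<xi>)"
    unfolding lie_equivalent_def
  proof (intro exI[of _ "image B"] conjI ballI)
    show "lie_sphere_transformation (image B)" using B by (rule lie_similarity_transformation)
    fix x assume x: "x \<in> topspace M"
    have "image B ` lam x = proj_line_through (B (Z x)) (B (W x))"
      unfolding lam[OF x] using image_proj[OF lin(1)] by (rule image_proj_line[OF lin])
    then show "legendre_lift f \<xi> x = image B ` lam x"
      using span[OF x] by (simp add: legendre_lift_def span_pair_eq_iff_proj_line)
  qed
  ultimately show ?thesis by blast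
qed

end

theorem theorem9p3:
  fixes n g :: nat
    and M :: "'p topology"
    and A :: "('p, 'm::finite) chart set"
    and lam :: "'p \<Rightarrow> 'k::finite lvec set set"
  assumes "n \<ge> 2"
    and "CARD('m) = n - 1"
    and "CARD('k) = n + 1"
    and "smooth_manifold M A"
    and "legendre_submanifold M A lam"
    and "\<forall>x\<in>topspace M. finite (curvature_spheres M A lam x) \<and>
           card (curvature_spheres M A lam x) = g"
  shows "(\<exists>(f :: 'p \<Rightarrow> real ^ 'k) \<xi>.
            isoparametric M A f \<xi> \<and> lie_equivalent M lam (legendre_lift f \<xi>)) \<longleftrightarrow>
         (\<exists>(P :: nat \<Rightarrow> 'k lvec) L.
            timelike_line L \<and> (\<forall>i\<in>{1..g}. P i \<noteq> 0 \<and> proj (P i) \<in> L) \<and>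
            (\<forall>x\<in>topspace M. \<exists>K :: nat \<Rightarrow> 'k lvec.
               bij_betw (\<lambda>i. proj (K i)) {1..g} (curvature_spheres M A lam x) \<and>
               (\<forall>i\<in>{1..g}. lie_prod (K i) (P i) = 0)))"
    (is "?iso \<longleftrightarrow> ?points")
proof
  interpret manifold M A using assms(4) by unfold_locales
  have card: "CARD('k) = CARD('m) + 2" using assms(1-3) by simp
  show ?points if ?iso
  proof -
    obtain f \<xi> where *: "isoparametric M A f \<xi>" "lie_equivalent M lam (legendre_lift f \<xi>)"
      using \<open>?iso\<close> by blast
    show ?thesis
      using assms(6) by (intro isoparametric_imp_orthogonal_points[OF card assms(5) _ *]) blast
  qed
  show ?iso if ?points
  proof -
    obtain P L where "timelike_line L" "\<And>i. i \<in> {1..g} \<Longrightarrow> P i \<noteq> 0 \<and> proj (P i) \<in> L"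
      "\<And>x. x \<in> topspace M \<Longrightarrow> \<exists>K :: nat \<Rightarrow> 'k lvec.
        bij_betw (\<lambda>i. proj (K i)) {1..g} (curvature_spheres M A lam x) \<and>
        (\<forall>i\<in>{1..g}. lie_prod (K i) (P i) = 0)"
      using \<open>?points\<close> by blast
    then show ?thesis by (rule orthogonal_points_imp_isoparametric[OF card assms(5)])
  qed
qed

end
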